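(* Let $n\ge m\ge 1$. Let $G$ be a finite nonabelian $2$-group with a central subgroup $N\cong\mathbb{Z}_{2^n}\times\mathbb{Z}_{2^m}$ such that $G/N$ is an elementary abelian $2$-group, and with $G'=\langle c\rangle\cong\mathbb{Z}_2$. Suppose that the center of $G$ is $$\zeta G=\langle z_1\rangle\times\langle z_2\rangle\times\cdots\times\langle z_r\rangle\cong\mathbb{Z}_{2^{n+1}}\times\mathbb{Z}_{2^{m+1}}\times\underbrace{\mathbb{Z}_2\times\cdots\times\mathbb{Z}_2}_{r-2},\qquad N=\langle z_1^2\rangle\times\langle z_2^2\rangle$$ (with $|z_1|=2^{n+1}$, $|z_2|=2^{m+1}$), and that $c\in\langle z_1\rangle$ or $c\in\langle z_2\rangle$. Then $G$ is isomorphic to one of the following groups, for an integer $k\ge 1$, where $\mathbb{Z}_2^{(r-2)}$ is the direct product of $r-2$ copies of $\mathbb{Z}_2$: (i) $\bigl(D_8^{\mathsf Y k}\mathbin{\mathsf Y}(\mathbb{Z}_{2^{n+1}}\times\mathbb{Z}_{2^{m+1}})\bigr)\times\mathbb{Z}_2^{(r-2)}$; (ii) $\bigl(Q_8\mathbin{\mathsf Y}D_8^{\mathsf Y(k-1)}\mathbin{\mathsf Y}(\mathbb{Z}_{2^{n+1}}\times\mathbb{Z}_{2^{m+1}})\bigr)\times\mathbb{Z}_2^{(r-2)}$.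
   Context: $D_8$, $Q_8$ are the dihedral and quaternion groups of order $8$. $H\mathbin{\mathsf Y}K$ denotes the central product (a group $HK$ with $[H,K]=1$). In the central products listed, factors intersect exactly in a common subgroup $\langle c\rangle$ of order $2$: the derived subgroups (of order $2$) of the nonabelian factors are identified with each other and with the subgroup of order $2$ of the cyclic factor $\mathbb{Z}_{2^{n+1}}=\langle z_1\rangle$ when $c\in\langle z_1\rangle$, respectively of the cyclic factor $\mathbb{Z}_{2^{m+1}}=\langle z_2\rangle$ when $c\in\langle z_2\rangle$. $D_8^{\mathsf Y j}$ is the central product of $j$ copies of $D_8$ (omitted if $j=0$). *)

theory Defs
  imports "HOL-Algebra.Algebra"
begin

definition center :: "('a, 'b) monoid_scheme \<Rightarrow> 'a set" where
  "center G = {x \<in> carrier G. \<forall>y \<in> carrier G. x \<otimes>\<^bsub>G\<^esub> y = y \<otimes>\<^bsub>G\<^esub> x}"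

definition elementary_abelian_2_group :: "('a, 'b) monoid_scheme \<Rightarrow> bool" where
  "elementary_abelian_2_group G \<longleftrightarrow>
     comm_group G \<and> (\<forall>x \<in> carrier G. x \<otimes>\<^bsub>G\<^esub> x = \<one>\<^bsub>G\<^esub>)"

definition internal_direct_product ::
    "('a, 'b) monoid_scheme \<Rightarrow> 'a set \<Rightarrow> 'i set \<Rightarrow> ('i \<Rightarrow> 'a set) \<Rightarrow> bool" where
  "internal_direct_product G K I H \<longleftrightarrow>
     subgroup K G \<and> (\<forall>i \<in> I. H i \<lhd> G\<lparr>carrier := K\<rparr>) \<and>
     K = generate G (\<Union>i \<in> I. H i) \<and>
     (\<forall>i \<in> I. H i \<inter> generate G (\<Union>j \<in> I - {i}. H j) = {\<one>\<^bsub>G\<^esub>})"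

text \<open>
  The pair \<open>(a, b)\<close> stands for \<open>r\<^sup>a s\<^sup>b\<close>, where \<open>r\<^sup>4 = 1\<close>, \<open>s r s\<^sup>-\<^sup>1 = r\<^sup>-\<^sup>1\<close>, and
  \<open>s\<^sup>2 = 1\<close> for the dihedral group, \<open>s\<^sup>2 = r\<^sup>2\<close> for the quaternion group (\<open>r = i\<close>, \<open>s = j\<close>).
  In both groups the involution that generates the derived subgroup is \<open>(2, 0)\<close>.
\<close>

definition D8 :: "(int \<times> int) monoid" where
  "D8 = \<lparr>carrier = {0..<4} \<times> {0..<2},
         monoid.mult = (\<lambda>(a, b) (a', b').
           ((a + (if b = 0 then a' else - a')) mod 4, (b + b') mod 2)),
         one = (0, 0)\<rparr>"

definition Q8 :: "(int \<times> int) monoid" where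
  "Q8 = \<lparr>carrier = {0..<4} \<times> {0..<2},
         monoid.mult = (\<lambda>(a, b) (a', b').
           ((a + (if b = 0 then a' else - a') + (if b = 1 \<and> b' = 1 then 2 else 0)) mod 4,
            (b + b') mod 2)),
         one = (0, 0)\<rparr>"

text \<open>
  The central product of two groups whose central involutions \<open>c\<close> and \<open>d\<close> are identified
  (\<open>d = d\<^sup>-\<^sup>1\<close>). Lemma \<open>central_product_factors\<close> below shows that the result is generated by
  commuting copies of the two factors which meet exactly in the common subgroup of order 2.
\<close>

definition central_product ::
    "('a, 'm) monoid_scheme \<Rightarrow> 'a \<Rightarrow> ('b, 'n) monoid_scheme \<Rightarrow> 'b \<Rightarrow> ('a \<times> 'b) set monoid" where
  "central_product H c K d = (H \<times>\<times> K) Mod {(\<one>\<^bsub>H\<^esub>, \<one>\<^bsub>K\<^esub>), (c, d)}"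

text \<open>
  The central product of a finite family of groups \<open>F i\<close>, with all the central involutions
  \<open>c i\<close> identified. The iterated product cannot be written as a recursion over
  \<^const>\<open>central_product\<close>, since the type would change at each step; hence the quotient of the
  full direct product by the even products of the \<open>c i\<close>. The odd products form the coset which is
  the common involution of the factors. Lemma \<open>central_product_family_insert\<close> below
  is the recursion.
\<close>

definition amalgam ::
    "'i set \<Rightarrow> ('i \<Rightarrow> ('a, 'm) monoid_scheme) \<Rightarrow> ('i \<Rightarrow> 'a) \<Rightarrow> ('i \<Rightarrow> 'a) set" where
  "amalgam I F c = {f \<in> (\<Pi>\<^sub>E i\<in>I. {\<one>\<^bsub>F i\<^esub>, c i}). even (card {i \<in> I. f i = c i})}"

definition central_product_family ::
    "'i set \<Rightarrow> ('i \<Rightarrow> ('a, 'm) monoid_scheme) \<Rightarrow> ('i \<Rightarrow> 'a) \<Rightarrow> ('i \<Rightarrow> 'a) set monoid" where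
  "central_product_family I F c = product_group I F Mod amalgam I F c"

definition common_involution ::
    "'i set \<Rightarrow> ('i \<Rightarrow> ('a, 'm) monoid_scheme) \<Rightarrow> ('i \<Rightarrow> 'a) \<Rightarrow> ('i \<Rightarrow> 'a) set" where
  "common_involution I F c = {f \<in> (\<Pi>\<^sub>E i\<in>I. {\<one>\<^bsub>F i\<^esub>, c i}). odd (card {i \<in> I. f i = c i})}"

text \<open>
  With \<open>k \<ge> 1\<close> factors: \<open>F = (\<lambda>_. D8)\<close> gives the central product of \<open>k\<close> copies of \<open>D8\<close>, and
  \<open>F = (\<lambda>i. if i = 0 then Q8 else D8)\<close> that of \<open>Q8\<close> and \<open>k - 1\<close> copies of \<open>D8\<close>.
  The argument \<open>d\<close> is the involution of the abelian factor to be identified with the derived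
  subgroups of these factors.
\<close>

definition listed_group ::
    "(nat \<Rightarrow> (int \<times> int) monoid) \<Rightarrow> nat \<Rightarrow> nat \<Rightarrow> nat \<Rightarrow> nat \<Rightarrow> int \<times> int
      \<Rightarrow> (((nat \<Rightarrow> int \<times> int) set \<times> int \<times> int) set \<times> (nat \<Rightarrow> int)) monoid" where
  "listed_group F n m r k d =
     central_product
       (central_product_family {..<k} F (\<lambda>_. (2, 0)))
       (common_involution {..<k} F (\<lambda>_. (2, 0)))
       (integer_mod_group (2 ^ (n + 1)) \<times>\<times> integer_mod_group (2 ^ (m + 1))) d
     \<times>\<times> product_group {..<r - 2} (\<lambda>_. integer_mod_group 2)"

definition group_i where
  "group_i = listed_group (\<lambda>_. D8)"

definition group_ii where
  "group_ii = listed_group (\<lambda>i. if i = 0 then Q8 else D8)"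

lemma
  shows carrier_D8: "carrier D8 = {0..<4} \<times> {0..<2}"
    and one_D8: "\<one>\<^bsub>D8\<^esub> = (0, 0)"
    and mult_D8: "(a, b) \<otimes>\<^bsub>D8\<^esub> (a', b') = ((a + (if b = 0 then a' else - a')) mod 4, (b + b') mod 2)"
  by (simp_all add: D8_def)

lemma
  shows carrier_Q8: "carrier Q8 = {0..<4} \<times> {0..<2}"
    and one_Q8: "\<one>\<^bsub>Q8\<^esub> = (0, 0)"
    and mult_Q8: "(a, b) \<otimes>\<^bsub>Q8\<^esub> (a', b') = ((a + (if b = 0 then a' else - a') + (if b = 1 \<and> b' = 1 then 2 else 0)) mod 4, (b + b') mod 2)"
  by (simp_all add: Q8_def)

lemma group_D8: "group D8"
proof (rule groupI)
  fix x y z assume "x \<in> carrier D8" "y \<in> carrier D8" "z \<in> carrier D8"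
  moreover obtain a b a' b' a'' b'' where x: "x = (a, b)" "y = (a', b')" "z = (a'', b'')"
    by (metis surj_pair)
  ultimately have b: "b = 0 \<or> b = 1" "b' = 0 \<or> b' = 1" "b'' = 0 \<or> b'' = 1"
    by (auto simp: carrier_D8 one_D8 mult_D8)
  show "x \<otimes>\<^bsub>D8\<^esub> y \<otimes>\<^bsub>D8\<^esub> z = x \<otimes>\<^bsub>D8\<^esub> (y \<otimes>\<^bsub>D8\<^esub> z)"
    using b by (elim disjE; simp add: carrier_D8 one_D8 mult_D8 x mod_simps algebra_simps)
next
  fix x assume "x \<in> carrier D8"
  moreover obtain a b where x: "x = (a, b)"
    by (metis surj_pair)
  ultimately have b: "0 \<le> a" "a < 4" "b = 0 \<or> b = 1"
    by (auto simp: carrier_D8 one_D8 mult_D8)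
  have "(if b = 0 then (- a) mod 4 else a, b) \<otimes>\<^bsub>D8\<^esub> x = \<one>\<^bsub>D8\<^esub>"
    using b(3) by (elim disjE; simp add: carrier_D8 one_D8 mult_D8 x mod_simps)
  moreover have "(if b = 0 then (- a) mod 4 else a, b) \<in> carrier D8"
    using b x by (auto simp: carrier_D8 one_D8 mult_D8)
  ultimately show "\<exists>y\<in>carrier D8. y \<otimes>\<^bsub>D8\<^esub> x = \<one>\<^bsub>D8\<^esub>" by blast
qed (auto simp: carrier_D8 one_D8 mult_D8)

lemma group_Q8: "group Q8"
proof (rule groupI)
  fix x y z assume "x \<in> carrier Q8" "y \<in> carrier Q8" "z \<in> carrier Q8"
  moreover obtain a b a' b' a'' b'' where x: "x = (a, b)" "y = (a', b')" "z = (a'', b'')"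
    by (metis surj_pair)
  ultimately have b: "b = 0 \<or> b = 1" "b' = 0 \<or> b' = 1" "b'' = 0 \<or> b'' = 1"
    and a: "a = 0 \<or> a = 1 \<or> a = 2 \<or> a = 3" "a' = 0 \<or> a' = 1 \<or> a' = 2 \<or> a' = 3"
      "a'' = 0 \<or> a'' = 1 \<or> a'' = 2 \<or> a'' = 3"
    by (auto simp: carrier_Q8)
  show "x \<otimes>\<^bsub>Q8\<^esub> y \<otimes>\<^bsub>Q8\<^esub> z = x \<otimes>\<^bsub>Q8\<^esub> (y \<otimes>\<^bsub>Q8\<^esub> z)"
    unfolding x using b a by (elim disjE; hypsubst; simp add: mult_Q8)
next
  fix x assume "x \<in> carrier Q8"
  moreover obtain a b where x: "x = (a, b)"
    by (metis surj_pair)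
  ultimately have b: "0 \<le> a" "a < 4" "b = 0 \<or> b = 1"
    by (auto simp: carrier_Q8 one_Q8 mult_Q8)
  have "(if b = 0 then (- a) mod 4 else (a + 2) mod 4, b) \<otimes>\<^bsub>Q8\<^esub> x = \<one>\<^bsub>Q8\<^esub>"
    using b(3) by (elim disjE; simp add: carrier_Q8 one_Q8 mult_Q8 x; presburger)
  moreover have "(if b = 0 then (- a) mod 4 else (a + 2) mod 4, b) \<in> carrier Q8"
    using b x by (auto simp: carrier_Q8 one_Q8 mult_Q8)
  ultimately show "\<exists>y\<in>carrier Q8. y \<otimes>\<^bsub>Q8\<^esub> x = \<one>\<^bsub>Q8\<^esub>" by blast
qed (auto simp: carrier_Q8 one_Q8 mult_Q8)

lemma inv_D8:
  assumes "(a, b) \<in> carrier D8"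
  shows "inv\<^bsub>D8\<^esub> (a, b) = (if b = 0 then (- a) mod 4 else a, b)"
proof (rule group.inv_equality[OF group_D8])
  have "b = 0 \<or> b = 1"
    using assms by (auto simp: carrier_D8 one_D8 mult_D8)
  then show "(if b = 0 then (- a) mod 4 else a, b) \<otimes>\<^bsub>D8\<^esub> (a, b) = \<one>\<^bsub>D8\<^esub>"
    by (elim disjE; simp add: carrier_D8 one_D8 mult_D8 mod_simps)
qed (use assms in \<open>auto simp: carrier_D8 one_D8 mult_D8\<close>)

lemma inv_Q8:
  assumes "(a, b) \<in> carrier Q8"
  shows "inv\<^bsub>Q8\<^esub> (a, b) = (if b = 0 then (- a) mod 4 else (a + 2) mod 4, b)"
proof (rule group.inv_equality[OF group_Q8])
  have "b = 0 \<or> b = 1"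
    using assms by (auto simp: carrier_Q8 one_Q8 mult_Q8)
  then show "(if b = 0 then (- a) mod 4 else (a + 2) mod 4, b) \<otimes>\<^bsub>Q8\<^esub> (a, b) = \<one>\<^bsub>Q8\<^esub>"
    by (elim disjE; simp add: carrier_Q8 one_Q8 mult_Q8; presburger)
qed (use assms in \<open>auto simp: carrier_Q8 one_Q8 mult_Q8\<close>)

lemma derived_D8: "derived D8 (carrier D8) = {(0, 0), (2, 0)}"
proof
  have "x \<otimes>\<^bsub>D8\<^esub> y \<otimes>\<^bsub>D8\<^esub> inv\<^bsub>D8\<^esub> x \<otimes>\<^bsub>D8\<^esub> inv\<^bsub>D8\<^esub> y \<in> {(0, 0), (2, 0)}"
    if xy: "x \<in> carrier D8" "y \<in> carrier D8" for x y
  proof -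
    obtain a b a' b' where x: "x = (a, b)" "y = (a', b')"
      by (metis surj_pair)
    have b: "b = 0 \<or> b = 1" "b' = 0 \<or> b' = 1"
      using xy by (auto simp: carrier_D8 one_D8 mult_D8 x)
    have *: "t mod 4 = 0 \<or> t mod 4 = 2" if "even t" for t :: int
      using that by presburger
    show ?thesis
      using b xy by (elim disjE; simp add: inv_D8 x; simp add: carrier_D8 one_D8 mult_D8 mod_simps *)
  qed
  moreover have "subgroup {(0, 0), (2, 0)} D8"
    by (rule group.subgroupI[OF group_D8]) (auto simp: inv_D8 carrier_D8 one_D8 mult_D8)
  ultimately show "derived D8 (carrier D8) \<subseteq> {(0, 0), (2, 0)}"
    unfolding derived_def
    by (intro group.generate_subgroup_incl[OF group_D8]) blast+
  have "(1, 0) \<in> carrier D8" "(0, 1) \<in> carrier D8"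
    by (auto simp: carrier_D8 one_D8 mult_D8)
  moreover from this have "(1, 0) \<otimes>\<^bsub>D8\<^esub> (0, 1) \<otimes>\<^bsub>D8\<^esub> inv\<^bsub>D8\<^esub> (1, 0) \<otimes>\<^bsub>D8\<^esub> inv\<^bsub>D8\<^esub> (0, 1) = (2, 0)"
    by (simp add: inv_D8) (simp add: carrier_D8 one_D8 mult_D8)
  ultimately have "(2, 0) \<in> derived_set D8 (carrier D8)"
    by (metis (no_types, lifting) UN_I singletonI)
  then show "{(0, 0), (2, 0)} \<subseteq> derived D8 (carrier D8)"
    unfolding derived_def using generate.one[of D8] by (auto simp: one_D8 intro: generate.incl)
qed

lemma derived_Q8: "derived Q8 (carrier Q8) = {(0, 0), (2, 0)}"
proof
  have "x \<otimes>\<^bsub>Q8\<^esub> y \<otimes>\<^bsub>Q8\<^esub> inv\<^bsub>Q8\<^esub> x \<otimes>\<^bsub>Q8\<^esub> inv\<^bsub>Q8\<^esub> y \<in> {(0, 0), (2, 0)}"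
    if xy: "x \<in> carrier Q8" "y \<in> carrier Q8" for x y
  proof -
    obtain a b a' b' where x: "x = (a, b)" "y = (a', b')"
      by (metis surj_pair)
    have b: "b = 0 \<or> b = 1" "b' = 0 \<or> b' = 1"
      "a = 0 \<or> a = 1 \<or> a = 2 \<or> a = 3" "a' = 0 \<or> a' = 1 \<or> a' = 2 \<or> a' = 3"
      using xy by (auto simp: carrier_Q8 one_Q8 mult_Q8 x)
    show ?thesis
      unfolding x using b by (elim disjE; hypsubst; simp add: inv_Q8 carrier_Q8 mult_Q8)
  qed
  moreover have "subgroup {(0, 0), (2, 0)} Q8"
    by (rule group.subgroupI[OF group_Q8]) (auto simp: inv_Q8 carrier_Q8 one_Q8 mult_Q8)
  ultimately show "derived Q8 (carrier Q8) \<subseteq> {(0, 0), (2, 0)}"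
    unfolding derived_def
    by (intro group.generate_subgroup_incl[OF group_Q8]) blast+
  have "(1, 0) \<in> carrier Q8" "(0, 1) \<in> carrier Q8"
    by (auto simp: carrier_Q8 one_Q8 mult_Q8)
  moreover from this have "(1, 0) \<otimes>\<^bsub>Q8\<^esub> (0, 1) \<otimes>\<^bsub>Q8\<^esub> inv\<^bsub>Q8\<^esub> (1, 0) \<otimes>\<^bsub>Q8\<^esub> inv\<^bsub>Q8\<^esub> (0, 1) = (2, 0)"
    by (simp add: inv_Q8) (simp add: carrier_Q8 one_Q8 mult_Q8)
  ultimately have "(2, 0) \<in> derived_set Q8 (carrier Q8)"
    by (metis (no_types, lifting) UN_I singletonI)
  then show "{(0, 0), (2, 0)} \<subseteq> derived Q8 (carrier Q8)"
    unfolding derived_def using generate.one[of Q8] by (auto simp: one_Q8 intro: generate.incl)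
qed

definition central_involution :: "('a, 'm) monoid_scheme \<Rightarrow> 'a \<Rightarrow> bool" where
  "central_involution G c \<longleftrightarrow> c \<in> center G \<and> c \<noteq> \<one>\<^bsub>G\<^esub> \<and> c \<otimes>\<^bsub>G\<^esub> c = \<one>\<^bsub>G\<^esub>"

lemma central_involutionD:
  assumes "central_involution G c"
  shows "c \<in> carrier G" "c \<noteq> \<one>\<^bsub>G\<^esub>" "c \<otimes>\<^bsub>G\<^esub> c = \<one>\<^bsub>G\<^esub>"
    and "x \<in> carrier G \<Longrightarrow> c \<otimes>\<^bsub>G\<^esub> x = x \<otimes>\<^bsub>G\<^esub> c"
  using assms by (auto simp: central_involution_def center_def)

lemma (in group) central_subgroup_normal:
  assumes "subgroup S G" and "S \<subseteq> center G"
  shows "S \<lhd> G"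
proof -
  have "x \<otimes> h \<otimes> inv x = h" if "x \<in> carrier G" "h \<in> S" for x h
  proof -
    have "h \<in> carrier G" "x \<otimes> h = h \<otimes> x"
      using that assms(2) by (auto simp: center_def)
    then show ?thesis
      using that by (simp add: m_assoc)
  qed
  then show ?thesis
    using assms(1) by (simp add: normal_inv_iff)
qed

context
  fixes H :: "('a, 'm) monoid_scheme" and K :: "('b, 'n) monoid_scheme" and c d
  assumes H: "group H" and K: "group K"
    and c: "central_involution H c" and d: "central_involution K d"
begin

interpretation H: group H by (rule H)
interpretation K: group K by (rule K)
interpretation HK: group "H \<times>\<times> K" by (rule DirProd_group[OF H K])

private abbreviation U where "U \<equiv> {(\<one>\<^bsub>H\<^esub>, \<one>\<^bsub>K\<^esub>), (c, d)}"

private lemma U_coset: "x \<in> carrier H \<Longrightarrow> y \<in> carrier K \<Longrightarrow>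
    U #>\<^bsub>H \<times>\<times> K\<^esub> (x, y) = {(x, y), (c \<otimes>\<^bsub>H\<^esub> x, d \<otimes>\<^bsub>K\<^esub> y)}"
  by (auto simp: r_coset_def)

lemma central_product_normal: "U \<lhd> H \<times>\<times> K"
proof (rule HK.central_subgroup_normal)
  show "subgroup U (H \<times>\<times> K)"
  proof (rule HK.subgroupI)
    show "inv\<^bsub>H \<times>\<times> K\<^esub> a \<in> U" if "a \<in> U" for a
    proof -
      have "inv\<^bsub>H\<^esub> c = c" "inv\<^bsub>K\<^esub> d = d"
        using central_involutionD(1,3)[OF c] central_involutionD(1,3)[OF d]
        by (simp_all add: H.inv_equality K.inv_equality)
      then show ?thesis
        using that central_involutionD(1)[OF c] central_involutionD(1)[OF d]
        by (auto simp: inv_DirProd[OF H K])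
    qed
  qed (use central_involutionD(1-3)[OF c] central_involutionD(1-3)[OF d] in auto)
  show "U \<subseteq> center (H \<times>\<times> K)"
    using c d by (auto simp: central_involution_def center_def)
qed

lemma group_central_product: "group (central_product H c K d)"
  unfolding central_product_def by (rule normal.factorgroup_is_group[OF central_product_normal])

lemma central_product_factors:
  defines "P \<equiv> central_product H c K d"
  defines "p \<equiv> \<lambda>x. U #>\<^bsub>H \<times>\<times> K\<^esub> (x, \<one>\<^bsub>K\<^esub>)" and "q \<equiv> \<lambda>y. U #>\<^bsub>H \<times>\<times> K\<^esub> (\<one>\<^bsub>H\<^esub>, y)"
  shows "p \<in> mon H P" "q \<in> mon K P"
    and "\<And>x y. x \<in> carrier H \<Longrightarrow> y \<in> carrier K \<Longrightarrow> p x \<otimes>\<^bsub>P\<^esub> q y = q y \<otimes>\<^bsub>P\<^esub> p x"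
    and "carrier P = p ` carrier H <#>\<^bsub>P\<^esub> q ` carrier K"
    and "p c = q d" "p ` carrier H \<inter> q ` carrier K = {\<one>\<^bsub>P\<^esub>, p c}"
proof -
  note cD = central_involutionD(1-3)[OF c] and dD = central_involutionD(1-3)[OF d]
  interpret U: normal U "H \<times>\<times> K" by (rule central_product_normal)
  have P: "carrier P = (\<lambda>a. U #>\<^bsub>H \<times>\<times> K\<^esub> a) ` (carrier H \<times> carrier K)"
    and one: "\<one>\<^bsub>P\<^esub> = U"
    by (auto simp: P_def central_product_def FactGroup_def RCOSETS_def)
  have mult: "(U #>\<^bsub>H \<times>\<times> K\<^esub> a) \<otimes>\<^bsub>P\<^esub> (U #>\<^bsub>H \<times>\<times> K\<^esub> b) = U #>\<^bsub>H \<times>\<times> K\<^esub> (a \<otimes>\<^bsub>H \<times>\<times> K\<^esub> b)"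
    if "a \<in> carrier (H \<times>\<times> K)" "b \<in> carrier (H \<times>\<times> K)" for a b
    using U.rcos_sum[OF that] by (simp add: P_def central_product_def FactGroup_def)
  have "p x \<otimes>\<^bsub>P\<^esub> p y = p (x \<otimes>\<^bsub>H\<^esub> y)" if "x \<in> carrier H" "y \<in> carrier H" for x y
    using that by (simp add: p_def mult)
  moreover have "inj_on p (carrier H)"
    using cD dD by (auto simp: inj_on_def p_def U_coset doubleton_eq_iff)
  ultimately show "p \<in> mon H P"
    by (auto simp: mon_def hom_def P p_def)
  have "q x \<otimes>\<^bsub>P\<^esub> q y = q (x \<otimes>\<^bsub>K\<^esub> y)" if "x \<in> carrier K" "y \<in> carrier K" for x y
    using that by (simp add: q_def mult)
  moreover have "inj_on q (carrier K)"
    using cD dD by (auto simp: inj_on_def q_def U_coset doubleton_eq_iff)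
  ultimately show "q \<in> mon K P"
    by (auto simp: mon_def hom_def P q_def)
  show "p x \<otimes>\<^bsub>P\<^esub> q y = q y \<otimes>\<^bsub>P\<^esub> p x" if "x \<in> carrier H" "y \<in> carrier K" for x y
    using that by (simp add: p_def q_def mult)
  show "p c = q d"
    using cD dD by (auto simp: p_def q_def U_coset)
  show "carrier P = p ` carrier H <#>\<^bsub>P\<^esub> q ` carrier K"
    by (force simp: set_mult_def P p_def q_def mult)
  show "p ` carrier H \<inter> q ` carrier K = {\<one>\<^bsub>P\<^esub>, p c}"
  proof
    show "p ` carrier H \<inter> q ` carrier K \<subseteq> {\<one>\<^bsub>P\<^esub>, p c}"
    proof
      fix W assume "W \<in> p ` carrier H \<inter> q ` carrier K"
      then obtain x y where x: "x \<in> carrier H" "W = p x" and y: "y \<in> carrier K" "W = q y"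
        by blast
      have "(x, \<one>\<^bsub>K\<^esub>) \<in> p x"
        using x by (simp add: p_def U_coset)
      then have "(x, \<one>\<^bsub>K\<^esub>) \<in> q y"
        using x y by simp
      then have "x = \<one>\<^bsub>H\<^esub> \<or> x = c"
        using y cD by (auto simp: q_def U_coset)
      moreover have "p \<one>\<^bsub>H\<^esub> = \<one>\<^bsub>P\<^esub>"
        using cD dD by (simp add: p_def U_coset one)
      ultimately show "W \<in> {\<one>\<^bsub>P\<^esub>, p c}"
        using x by auto
    qed
    have "p \<one>\<^bsub>H\<^esub> = \<one>\<^bsub>P\<^esub>" "q \<one>\<^bsub>K\<^esub> = \<one>\<^bsub>P\<^esub>"
      using cD dD by (simp_all add: p_def q_def U_coset one)
    then show "{\<one>\<^bsub>P\<^esub>, p c} \<subseteq> p ` carrier H \<inter> q ` carrier K"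
      using cD(1) dD(1) \<open>p c = q d\<close> by (metis H.one_closed Int_iff K.one_closed empty_subsetI imageI insert_subset)
  qed
qed

end

context
  fixes I :: "'i set" and F :: "'i \<Rightarrow> ('a, 'm) monoid_scheme" and c :: "'i \<Rightarrow> 'a"
  assumes fin: "finite I" and F: "\<And>i. i \<in> I \<Longrightarrow> group (F i)"
    and c: "\<And>i. i \<in> I \<Longrightarrow> central_involution (F i) (c i)"
begin

interpretation P: group "product_group I F" by (simp add: F)

private abbreviation E where "E \<equiv> \<Pi>\<^sub>E i\<in>I. {\<one>\<^bsub>F i\<^esub>, c i}"

private lemma E_center: "f \<in> E \<Longrightarrow> f \<in> center (product_group I F)"
proof -
  assume f: "f \<in> E"
  have "f i \<in> carrier (F i) \<and> (\<forall>x \<in> carrier (F i). f i \<otimes>\<^bsub>F i\<^esub> x = x \<otimes>\<^bsub>F i\<^esub> f i)" if "i \<in> I" for i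
  proof -
    interpret group "F i" by (rule F[OF that])
    have "f i = \<one>\<^bsub>F i\<^esub> \<or> f i = c i" using f that by auto
    then show ?thesis using central_involutionD[OF c[OF that]] by (metis l_one r_one one_closed)
  qed
  then show ?thesis
    using f by (auto simp: center_def PiE_iff fun_eq_iff)
qed

private lemma E_mult:
  assumes f: "f \<in> E" and g: "g \<in> E"
  shows "f \<otimes>\<^bsub>product_group I F\<^esub> g \<in> E"
    and "even (card {i \<in> I. (f \<otimes>\<^bsub>product_group I F\<^esub> g) i = c i}) \<longleftrightarrow>
      (even (card {i \<in> I. f i = c i}) \<longleftrightarrow> even (card {i \<in> I. g i = c i}))"
proof -
  have *: "(f i \<otimes>\<^bsub>F i\<^esub> g i = \<one>\<^bsub>F i\<^esub> \<or> f i \<otimes>\<^bsub>F i\<^esub> g i = c i) \<and>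
      (f i \<otimes>\<^bsub>F i\<^esub> g i = c i \<longleftrightarrow> (f i = c i) \<noteq> (g i = c i))" if "i \<in> I" for i
  proof -
    interpret group "F i" by (rule F[OF that])
    have "f i = \<one>\<^bsub>F i\<^esub> \<or> f i = c i" "g i = \<one>\<^bsub>F i\<^esub> \<or> g i = c i" using f g that by auto
    then show ?thesis using central_involutionD(1-3)[OF c[OF that]] by (elim disjE) auto
  qed
  show "f \<otimes>\<^bsub>product_group I F\<^esub> g \<in> E"
    using * by auto
  define A B where "A = {i \<in> I. f i = c i}" and "B = {i \<in> I. g i = c i}"
  have AB: "finite A" "finite B" using fin by (auto simp: A_def B_def)
  have "{i \<in> I. (f \<otimes>\<^bsub>product_group I F\<^esub> g) i = c i} = (A - B) \<union> (B - A)"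
    using * by (auto simp: A_def B_def)
  moreover have "card ((A - B) \<union> (B - A)) = card (A - B) + card (B - A)"
    using AB by (intro card_Un_disjoint) auto
  moreover have "card A = card (A - B) + card (A \<inter> B)" "card B = card (B - A) + card (A \<inter> B)"
    using AB by (metis card_Diff_subset_Int card_mono finite_Int inf_commute inf_le1 le_add_diff_inverse2)+
  ultimately show "even (card {i \<in> I. (f \<otimes>\<^bsub>product_group I F\<^esub> g) i = c i}) \<longleftrightarrow>
      (even (card {i \<in> I. f i = c i}) \<longleftrightarrow> even (card {i \<in> I. g i = c i}))"
    unfolding A_def[symmetric] B_def[symmetric] by simp presburger
qed

private lemma E_square: "f \<in> E \<Longrightarrow> f \<otimes>\<^bsub>product_group I F\<^esub> f = \<one>\<^bsub>product_group I F\<^esub>"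
proof -
  assume f: "f \<in> E"
  have "f i \<otimes>\<^bsub>F i\<^esub> f i = \<one>\<^bsub>F i\<^esub>" if "i \<in> I" for i
  proof -
    interpret group "F i" by (rule F[OF that])
    have "f i = \<one>\<^bsub>F i\<^esub> \<or> f i = c i" using f that by auto
    then show ?thesis using central_involutionD(1-3)[OF c[OF that]] by auto
  qed
  then show ?thesis by (auto simp: fun_eq_iff)
qed

lemma amalgam_normal: "amalgam I F c \<lhd> product_group I F"
proof (rule P.central_subgroup_normal)
  have one: "\<one>\<^bsub>product_group I F\<^esub> \<in> amalgam I F c"
  proof -
    have "{i \<in> I. (\<lambda>i\<in>I. \<one>\<^bsub>F i\<^esub>) i = c i} = {}"
      using central_involutionD(2)[OF c] by fastforce
    then have "even (card {i \<in> I. (\<lambda>i\<in>I. \<one>\<^bsub>F i\<^esub>) i = c i})"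
      by (metis card.empty even_zero)
    then show ?thesis
      by (auto simp: amalgam_def)
  qed
  have car: "amalgam I F c \<subseteq> carrier (product_group I F)"
    using E_center by (auto simp: amalgam_def center_def)
  show "subgroup (amalgam I F c) (product_group I F)"
  proof (rule P.subgroupI)
    show "amalgam I F c \<subseteq> carrier (product_group I F)" by (rule car)
    show "amalgam I F c \<noteq> {}" using one by blast
    show "inv\<^bsub>product_group I F\<^esub> f \<in> amalgam I F c" if "f \<in> amalgam I F c" for f
    proof -
      have "f \<in> carrier (product_group I F)" using that car by (rule subsetD[rotated])
      then have "inv\<^bsub>product_group I F\<^esub> f = f"
        using that E_square[of f] by (intro P.inv_equality) (auto simp: amalgam_def)
      then show ?thesis using that by simp
    qed
    show "f \<otimes>\<^bsub>product_group I F\<^esub> g \<in> amalgam I F c" if "f \<in> amalgam I F c" "g \<in> amalgam I F c" for f g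
      using that E_mult[of f g] unfolding amalgam_def mem_Collect_eq by blast
  qed
  show "amalgam I F c \<subseteq> center (product_group I F)"
    using E_center by (auto simp: amalgam_def)
qed

lemma group_central_product_family: "group (central_product_family I F c)"
  unfolding central_product_family_def by (rule normal.factorgroup_is_group[OF amalgam_normal])

lemma common_involution_coset:
  assumes g: "g \<in> common_involution I F c"
  shows "common_involution I F c = amalgam I F c #>\<^bsub>product_group I F\<^esub> g"
proof
  have gE: "g \<in> E" using g by (simp add: common_involution_def)
  have gC: "g \<in> carrier (product_group I F)" using E_center[OF gE] by (simp add: center_def)
  show "common_involution I F c \<subseteq> amalgam I F c #>\<^bsub>product_group I F\<^esub> g"
  proof
    fix f assume f: "f \<in> common_involution I F c"
    then have fE: "f \<in> E" by (simp add: common_involution_def)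
    have fC: "f \<in> carrier (product_group I F)" using E_center[OF fE] by (simp add: center_def)
    have "f \<otimes>\<^bsub>product_group I F\<^esub> g \<in> amalgam I F c"
      using E_mult[OF fE gE] f g unfolding amalgam_def common_involution_def mem_Collect_eq by blast
    moreover have "f \<otimes>\<^bsub>product_group I F\<^esub> g \<otimes>\<^bsub>product_group I F\<^esub> g = f"
      using P.m_assoc[OF fC gC gC] E_square[OF gE] P.r_one[OF fC] by metis
    ultimately show "f \<in> amalgam I F c #>\<^bsub>product_group I F\<^esub> g"
      unfolding r_coset_def by (metis UN_I singletonI)
  qed
  show "amalgam I F c #>\<^bsub>product_group I F\<^esub> g \<subseteq> common_involution I F c"
  proof
    fix f assume "f \<in> amalgam I F c #>\<^bsub>product_group I F\<^esub> g"
    then obtain h where h: "h \<in> amalgam I F c" "f = h \<otimes>\<^bsub>product_group I F\<^esub> g"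
      unfolding r_coset_def by blast
    then have "h \<in> E" by (simp add: amalgam_def)
    from E_mult[OF this gE] h g show "f \<in> common_involution I F c"
      unfolding amalgam_def common_involution_def mem_Collect_eq by blast
  qed
qed

lemma common_involution_nonempty:
  assumes i: "i \<in> I"
  shows "(\<lambda>j\<in>I. if j = i then c i else \<one>\<^bsub>F j\<^esub>) \<in> common_involution I F c"
proof -
  have "{j \<in> I. (\<lambda>j\<in>I. if j = i then c i else \<one>\<^bsub>F j\<^esub>) j = c j} = {i}"
    using i central_involutionD(2)[OF c] by (auto split: if_splits) metis
  then have "odd (card {j \<in> I. (\<lambda>j\<in>I. if j = i then c i else \<one>\<^bsub>F j\<^esub>) j = c j})"
    by (metis card_1_singleton_iff One_nat_def odd_one)
  then show ?thesis
    by (auto simp: common_involution_def)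
qed

lemma central_involution_family:
  assumes "I \<noteq> {}"
  shows "central_involution (central_product_family I F c) (common_involution I F c)"
proof -
  interpret N: normal "amalgam I F c" "product_group I F" by (rule amalgam_normal)
  obtain g where g: "g \<in> common_involution I F c"
    using assms common_involution_nonempty by blast
  have gE: "g \<in> E" using g by (simp add: common_involution_def)
  have gC: "g \<in> carrier (product_group I F)"
    and com: "x \<in> carrier (product_group I F) \<Longrightarrow>
      g \<otimes>\<^bsub>product_group I F\<^esub> x = x \<otimes>\<^bsub>product_group I F\<^esub> g" for x
    using E_center[OF gE] unfolding center_def by blast+
  have "common_involution I F c \<noteq> amalgam I F c"
    using g by (auto simp: common_involution_def amalgam_def)
  moreover have "common_involution I F c \<in> center (central_product_family I F c)"
    unfolding common_involution_coset[OF g] center_def central_product_family_def FactGroup_def RCOSETS_def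
    using gC com by (auto simp del: carrier_product_group mult_product_group simp: N.rcos_sum)
  moreover have "common_involution I F c <#>\<^bsub>product_group I F\<^esub> common_involution I F c = amalgam I F c"
    unfolding common_involution_coset[OF g] N.rcos_sum[OF gC gC] E_square[OF gE]
    by (rule P.coset_mult_one[OF N.subset])
  ultimately show ?thesis
    by (simp add: central_involution_def central_product_family_def FactGroup_def)
qed

end

lemma central_product_family_insert:
  fixes F :: "'i \<Rightarrow> ('a, 'm) monoid_scheme"
  assumes I: "finite I" "I \<noteq> {}" "i \<notin> I" and F: "\<And>j. j \<in> insert i I \<Longrightarrow> group (F j)"
    and c: "\<And>j. j \<in> insert i I \<Longrightarrow> central_involution (F j) (c j)"
  shows "central_product_family (insert i I) F c \<cong>
    central_product (central_product_family I F c) (common_involution I F c) (F i) (c i)"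
proof -
  let ?G = "product_group (insert i I) F" and ?L = "product_group I F"
  let ?A = "amalgam I F c" and ?C = "common_involution I F c" and ?Q = "central_product_family I F c"
  let ?R = "?Q \<times>\<times> F i" and ?U = "{(\<one>\<^bsub>?Q\<^esub>, \<one>\<^bsub>F i\<^esub>), (?C, c i)}"
  have hyp: "finite I" "\<And>j. j \<in> I \<Longrightarrow> group (F j)" "\<And>j. j \<in> I \<Longrightarrow> central_involution (F j) (c j)"
    using I F c by auto
  have Q: "group ?Q" by (rule group_central_product_family[OF hyp])
  have C: "central_involution ?Q ?C" by (rule central_involution_family[OF hyp I(2)])
  have i: "group (F i)" "central_involution (F i) (c i)" using F c by auto
  interpret A: normal ?A ?L by (rule amalgam_normal[OF hyp])
  interpret U: normal ?U ?R by (rule central_product_normal[OF Q i(1) C i(2)])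
  let ?h = "\<lambda>f. (?A #>\<^bsub>?L\<^esub> restrict f I, f i)"
  have res: "restrict f I \<in> carrier ?L" if "f \<in> carrier ?G" for f
    using that by (auto simp: PiE_iff)
  have h: "?h \<in> hom ?G ?R"
  proof (rule homI)
    fix f assume f: "f \<in> carrier ?G"
    then show "?h f \<in> carrier ?R"
      using res[OF f] by (auto simp: central_product_family_def FactGroup_def RCOSETS_def simp del: carrier_product_group)
        (auto simp: PiE_iff)
  next
    fix f g assume fg: "f \<in> carrier ?G" "g \<in> carrier ?G"
    have "restrict (f \<otimes>\<^bsub>?G\<^esub> g) I = restrict f I \<otimes>\<^bsub>?L\<^esub> restrict g I"
      by (auto simp: fun_eq_iff)
    then show "?h (f \<otimes>\<^bsub>?G\<^esub> g) = ?h f \<otimes>\<^bsub>?R\<^esub> ?h g"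
      using A.rcos_sum[OF res[OF fg(1)] res[OF fg(2)]]
      by (simp add: central_product_family_def FactGroup_def)
  qed
  define k where "k = (\<lambda>f. ?U #>\<^bsub>?R\<^esub> ?h f)"
  let ?P = "central_product ?Q ?C (F i) (c i)"
  have k: "k \<in> hom ?G ?P"
    using hom_compose[OF h U.r_coset_hom_Mod] by (simp add: k_def central_product_def comp_def)
  have G: "group ?G" by (intro product_group F)
  interpret k: group_hom ?G ?P k
    using G group_central_product[OF Q i(1) C i(2)] k
    by (simp add: group_hom_def group_hom_axioms_def)
  have "k ` carrier ?G = carrier ?P"
  proof
    show "carrier ?P \<subseteq> k ` carrier ?G"
    proof
      fix W assume "W \<in> carrier ?P"
      then obtain g y where gy: "g \<in> carrier ?L" "y \<in> carrier (F i)"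
        and W: "W = ?U #>\<^bsub>?R\<^esub> (?A #>\<^bsub>?L\<^esub> g, y)"
        by (auto simp: central_product_def central_product_family_def FactGroup_def RCOSETS_def
            simp del: carrier_product_group)
      have r: "restrict (g(i := y)) I = g"
        using gy I(3) by (auto simp: PiE_iff extensional_def fun_eq_iff)
      have "k (g(i := y)) = W"
        by (simp add: k_def r W)
      moreover have "g(i := y) \<in> carrier ?G"
        using gy by (auto simp: PiE_iff extensional_def)
      ultimately show "W \<in> k ` carrier ?G" by blast
    qed
  qed (use k in \<open>auto simp: hom_def\<close>)
  moreover have "kernel ?G ?P k = amalgam (insert i I) F c"
  proof -
    have "f \<in> kernel ?G ?P k \<longleftrightarrow> f \<in> amalgam (insert i I) F c" if f: "f \<in> carrier ?G" for f
    proof -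
      have hf: "?h f \<in> carrier ?R" using h f by (auto simp: hom_def)
      have eq: "?A #>\<^bsub>?L\<^esub> g = ?A \<longleftrightarrow> g \<in> ?A" if "g \<in> carrier ?L" for g
        using that A.coset_join1 A.coset_join2 A.subgroup_axioms by metis
      have eqC: "?A #>\<^bsub>?L\<^esub> g = ?C \<longleftrightarrow> g \<in> ?C" if "g \<in> carrier ?L" for g
      proof
        assume "?A #>\<^bsub>?L\<^esub> g = ?C"
        then show "g \<in> ?C"
          using A.rcos_self[OF that A.subgroup_axioms] by simp
      qed (rule common_involution_coset[OF hyp, symmetric])
      have "f \<in> kernel ?G ?P k \<longleftrightarrow> ?U #>\<^bsub>?R\<^esub> ?h f = ?U"
        using f by (simp add: kernel_def k_def central_product_def FactGroup_def)
      also have "\<dots> \<longleftrightarrow> ?h f \<in> ?U"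
        using hf U.coset_join1 U.coset_join2 U.subgroup_axioms by metis
      also have "\<dots> \<longleftrightarrow> restrict f I \<in> ?A \<and> f i = \<one>\<^bsub>F i\<^esub> \<or> restrict f I \<in> ?C \<and> f i = c i"
        using eq[OF res[OF f]] eqC[OF res[OF f]] by (simp add: central_product_family_def FactGroup_def)
      also have "\<dots> \<longleftrightarrow> f \<in> amalgam (insert i I) F c"
      proof -
        have 1: "{j \<in> I. restrict f I j = c j} = {j \<in> I. f j = c j}" by auto
        have 2: "{j \<in> insert i I. f j = c j} =
            (if f i = c i then insert i {j \<in> I. f j = c j} else {j \<in> I. f j = c j})" by auto
        have 3: "card (insert i {j \<in> I. f j = c j}) = Suc (card {j \<in> I. f j = c j})"
          using I by simp
        have 4: "restrict f I \<in> (\<Pi>\<^sub>E j\<in>I. {\<one>\<^bsub>F j\<^esub>, c j}) \<longleftrightarrow> (\<forall>j\<in>I. f j \<in> {\<one>\<^bsub>F j\<^esub>, c j})"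
          by (auto simp: PiE_iff)
        have 5: "f \<in> (\<Pi>\<^sub>E j\<in>insert i I. {\<one>\<^bsub>F j\<^esub>, c j}) \<longleftrightarrow> (\<forall>j\<in>I. f j \<in> {\<one>\<^bsub>F j\<^esub>, c j}) \<and> f i \<in> {\<one>\<^bsub>F i\<^esub>, c i}"
          using f by (auto simp: PiE_iff)
        show ?thesis
          unfolding amalgam_def common_involution_def mem_Collect_eq 1 2 4 5
          using 3 central_involutionD(2)[OF i(2)] by auto
      qed
      finally show ?thesis .
    qed
    moreover have "amalgam (insert i I) F c \<subseteq> carrier ?G"
      using amalgam_normal[of "insert i I" F c] I F c
      by (meson finite_insert normal.axioms(1) subgroup.subset)
    ultimately show ?thesis
      unfolding kernel_def by blast
  qed
  ultimately show ?thesis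
    using k.FactGroup_iso by (simp add: central_product_family_def)
qed
lemma central_involution_D8: "central_involution D8 (2, 0)"
proof -
  have "(2, 0) \<otimes>\<^bsub>D8\<^esub> (a, b) = (a, b) \<otimes>\<^bsub>D8\<^esub> (2, 0)" for a b :: int
    by (simp add: mult_D8) presburger
  then show ?thesis
    by (auto simp: central_involution_def center_def carrier_D8 one_D8 mult_D8)
qed

lemma central_involution_Q8: "central_involution Q8 (2, 0)"
proof -
  have "(2, 0) \<otimes>\<^bsub>Q8\<^esub> (a, b) = (a, b) \<otimes>\<^bsub>Q8\<^esub> (2, 0)" for a b :: int
    by (simp add: mult_Q8) presburger
  then show ?thesis
    by (auto simp: central_involution_def center_def carrier_Q8 one_Q8 mult_Q8)
qed

lemma central_involution_integer_mod_group:
  "central_involution (integer_mod_group (2 ^ (n + 1))) (2 ^ n)"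
  by (auto simp: central_involution_def center_def carrier_integer_mod_group add.commute)

end

theory Submission
  imports Defs
begin

text \<open>
  Every square \<open>x\<^sup>2\<close> lies in \<open>N = \<langle>z\<^sub>1\<^sup>2\<rangle> \<times> \<langle>z\<^sub>2\<^sup>2\<rangle>\<close>, hence is the square of a central element
  \<open>w\<close>, and \<open>x w\<^sup>-\<^sup>1\<close> is an involution or trivial: every coset of the center contains an element of
  square 1. Two such elements that do not commute generate a copy of \<open>D8\<close>, and \<open>G\<close> is the
  product of this copy and its centralizer, because commutators take only the values \<open>1\<close> and \<open>c\<close>.
  Iterating, \<open>G\<close> is a central product of copies of \<open>D8\<close> and of its center, so the first
  alternative always holds; \<open>Q8\<close> does not show up because its central product with a cyclic group
  of order at least 4 is also a central product with \<open>D8\<close>.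
\<close>

text \<open>The listed group is a quotient of an outer direct product, so the internal factorization
  of \<open>G\<close> has to be turned into maps out of three successive constructions: the central
  product of the copies of \<open>D8\<close>, its central product with the two long cyclic factors,
  and the direct product with the remaining involutions. Each map multiplies commuting images, and
  the question each time is its kernel. One observation settles all three: a product of elements of
  the dihedral copies is central in \<open>G\<close> only if every factor is central in its own
  copy, so that the product is \<open>1\<close> or \<open>c\<close>. Since \<open>c\<close> lies in
  one of the two long cyclic factors, the overlap of the dihedral part with the center is absorbed
  by them, and the remaining involutions split off directly. This is also why the factorization is
  phrased with homomorphisms from \<open>D8\<close> and not with subgroups.\<close>

section \<open>Homomorphisms on quotients and on products of two groups\<close>

text \<open>The first isomorphism theorem with the value on cosets kept: images, and the value at
  the common involution, are computed from it later.\<close>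

lemma mon_FactGroup_lift:
  assumes "group G" and "group H" and h: "h \<in> hom G H" and "M \<lhd> G" and ker: "kernel G H h = M"
  obtains g where "g \<in> mon (G Mod M) H" and "\<And>x. x \<in> carrier G \<Longrightarrow> g (M #>\<^bsub>G\<^esub> x) = h x"
proof -
  interpret h: group_hom G H h
    using assms by (simp add: group_hom_def group_hom_axioms_def)
  obtain g where g: "g \<in> hom (G Mod M) H" "\<And>x. x \<in> carrier G \<Longrightarrow> g (M #>\<^bsub>G\<^esub> x) = h x"
    using h.FactGroup_universal_kernel[of M] assms by blast
  moreover have "inj_on g (carrier (G Mod M))"
  proof (rule inj_onI)
    fix U V assume "U \<in> carrier (G Mod M)" "V \<in> carrier (G Mod M)" and eq: "g U = g V"
    then obtain x y where xy: "x \<in> carrier G" "U = M #>\<^bsub>G\<^esub> x" "y \<in> carrier G" "V = M #>\<^bsub>G\<^esub> y"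
      by (auto simp: carrier_FactGroup)
    then have "h x = h y"
      using eq g(2) by simp
    then show "U = V"
      using h.FactGroup_subset[of x y] h.FactGroup_subset[of y x] xy ker by auto
  qed
  ultimately show thesis
    using that by (simp add: mon_def)
qed

lemma (in group) mult_4_commute:
  assumes "a \<in> carrier G" "b \<in> carrier G" "c \<in> carrier G" "d \<in> carrier G" and "b \<otimes> c = c \<otimes> b"
  shows "(a \<otimes> b) \<otimes> (c \<otimes> d) = (a \<otimes> c) \<otimes> (b \<otimes> d)"
proof -
  have "(a \<otimes> b) \<otimes> (c \<otimes> d) = a \<otimes> (b \<otimes> c) \<otimes> d"
    using assms(1-4) by (simp add: m_assoc)
  also have "\<dots> = (a \<otimes> c) \<otimes> (b \<otimes> d)"
    using assms by (simp add: m_assoc)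
  finally show ?thesis .
qed

lemma (in group) commute_mult:
  assumes "a \<in> carrier G" "b \<in> carrier G" "x \<in> carrier G"
    and "x \<otimes> a = a \<otimes> x" "x \<otimes> b = b \<otimes> x"
  shows "x \<otimes> (a \<otimes> b) = (a \<otimes> b) \<otimes> x"
  using assms by (metis m_assoc)

text \<open>The target is not abelian; the middle factors of
  \<open>f x \<otimes> f x' \<otimes> g y \<otimes> g y'\<close> can be exchanged only because the
  two images commute elementwise.\<close>

lemma (in group) hom_DirProd_mult:
  assumes "f \<in> hom H G" and "g \<in> hom K G"
    and "\<And>x y. x \<in> carrier H \<Longrightarrow> y \<in> carrier K \<Longrightarrow> f x \<otimes> g y = g y \<otimes> f x"
  shows "(\<lambda>(x, y). f x \<otimes> g y) \<in> hom (H \<times>\<times> K) G"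
proof (rule homI)
  fix p q assume "p \<in> carrier (H \<times>\<times> K)" "q \<in> carrier (H \<times>\<times> K)"
  then obtain x y x' y' where "p = (x, y)" "q = (x', y')" and xy: "x \<in> carrier H" "y \<in> carrier K"
    "x' \<in> carrier H" "y' \<in> carrier K"
    by auto
  then show "(\<lambda>(x, y). f x \<otimes> g y) (p \<otimes>\<^bsub>H \<times>\<times> K\<^esub> q) =
      (\<lambda>(x, y). f x \<otimes> g y) p \<otimes> (\<lambda>(x, y). f x \<otimes> g y) q"
    using mult_4_commute[of "f x" "f x'" "g y" "g y'"] mult_4_commute[of "f x" "g y" "f x'" "g y'"]
      assms(3)[OF xy(3) xy(2)]
    by (simp add: hom_mult[OF assms(1)] hom_mult[OF assms(2)] hom_in_carrier[OF assms(1)] hom_in_carrier[OF assms(2)])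
qed (use hom_in_carrier[OF assms(1)] hom_in_carrier[OF assms(2)] in auto)

section \<open>Ordered products of pairwise commuting homomorphisms\<close>

text \<open>\<open>finprod\<close> is of no use here, since the ambient group is not commutative.\<close>

primrec ordered_product ::
    "('a, 'b) monoid_scheme \<Rightarrow> (nat \<Rightarrow> 'c \<Rightarrow> 'a) \<Rightarrow> nat \<Rightarrow> (nat \<Rightarrow> 'c) \<Rightarrow> 'a" where
  "ordered_product G \<phi> 0 f = \<one>\<^bsub>G\<^esub>"
| "ordered_product G \<phi> (Suc k) f = ordered_product G \<phi> k f \<otimes>\<^bsub>G\<^esub> \<phi> k (f k)"

lemma ordered_product_cong:
  "(\<And>i. i < k \<Longrightarrow> \<phi> i (f i) = \<psi> i (g i)) \<Longrightarrow> ordered_product G \<phi> k f = ordered_product G \<psi> k g"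
  by (induction k) auto

text \<open>The subgroup is arbitrary because the lemma serves several purposes: closure in the
  carrier or the center, membership in the span of all cyclic factors but one, and triviality of a
  product of identities.\<close>

lemma (in group) ordered_product_mem_subgroup:
  "subgroup S G \<Longrightarrow> (\<And>i. i < k \<Longrightarrow> \<phi> i (f i) \<in> S) \<Longrightarrow> ordered_product G \<phi> k f \<in> S"
  by (induction k) (auto simp: subgroup.one_closed subgroup.m_closed)

lemmas (in group) ordered_product_closed = ordered_product_mem_subgroup[OF subgroup_self]

lemma (in group) ordered_product_commute:
  assumes "\<And>i. i < k \<Longrightarrow> \<phi> i (f i) \<in> carrier G" and "x \<in> carrier G"
    and "\<And>i. i < k \<Longrightarrow> x \<otimes> \<phi> i (f i) = \<phi> i (f i) \<otimes> x"
  shows "x \<otimes> ordered_product G \<phi> k f = ordered_product G \<phi> k f \<otimes> x"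
  using assms
proof (induction k)
  case (Suc k)
  then show ?case
    using commute_mult[of "ordered_product G \<phi> k f" "\<phi> k (f k)" x] by (simp add: ordered_product_closed)
qed simp

text \<open>Only elements of different factors have to commute: the induction step moves
  \<open>\<phi> k (f k)\<close> past the factors of \<open>g\<close> with smaller index, and inside
  factor \<open>k\<close> the order is preserved.\<close>

lemma (in group) ordered_product_mult:
  assumes "\<And>i. i < k \<Longrightarrow> \<phi> i \<in> hom (F i) G"
    and "\<And>i j x y. i < k \<Longrightarrow> j < k \<Longrightarrow> i \<noteq> j \<Longrightarrow> x \<in> carrier (F i) \<Longrightarrow> y \<in> carrier (F j) \<Longrightarrow>
      \<phi> i x \<otimes> \<phi> j y = \<phi> j y \<otimes> \<phi> i x"
    and "\<And>i. i < k \<Longrightarrow> f i \<in> carrier (F i)" and "\<And>i. i < k \<Longrightarrow> g i \<in> carrier (F i)"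
  shows "ordered_product G \<phi> k (\<lambda>i. f i \<otimes>\<^bsub>F i\<^esub> g i) = ordered_product G \<phi> k f \<otimes> ordered_product G \<phi> k g"
  using assms
proof (induction k)
  case (Suc k)
  have cl: "\<phi> i (f i) \<in> carrier G" "\<phi> i (g i) \<in> carrier G" if "i < Suc k" for i
    using Suc.prems that hom_in_carrier by metis+
  have "\<phi> k (f k) \<otimes> ordered_product G \<phi> k g = ordered_product G \<phi> k g \<otimes> \<phi> k (f k)"
    using cl Suc.prems by (intro ordered_product_commute) auto
  then have "ordered_product G \<phi> k f \<otimes> \<phi> k (f k) \<otimes> (ordered_product G \<phi> k g \<otimes> \<phi> k (g k)) =
      ordered_product G \<phi> k f \<otimes> ordered_product G \<phi> k g \<otimes> (\<phi> k (f k) \<otimes> \<phi> k (g k))"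
    using cl by (intro mult_4_commute ordered_product_closed) auto
  moreover have "\<phi> k (f k \<otimes>\<^bsub>F k\<^esub> g k) = \<phi> k (f k) \<otimes> \<phi> k (g k)"
    using Suc.prems by (metis hom_mult lessI)
  moreover have "ordered_product G \<phi> k (\<lambda>i. f i \<otimes>\<^bsub>F i\<^esub> g i) = ordered_product G \<phi> k f \<otimes> ordered_product G \<phi> k g"
    using Suc.prems by (intro Suc.IH) auto
  ultimately show ?case by simp
qed simp

lemma (in group) ordered_product_hom:
  assumes "\<And>i. i < k \<Longrightarrow> \<phi> i \<in> hom (F i) G"
    and "\<And>i j x y. i < k \<Longrightarrow> j < k \<Longrightarrow> i \<noteq> j \<Longrightarrow> x \<in> carrier (F i) \<Longrightarrow> y \<in> carrier (F j) \<Longrightarrow>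
      \<phi> i x \<otimes> \<phi> j y = \<phi> j y \<otimes> \<phi> i x"
  shows "ordered_product G \<phi> k \<in> hom (product_group {..<k} F) G"
proof (rule homI)
  fix f assume "f \<in> carrier (product_group {..<k} F)"
  then have "\<And>i. i < k \<Longrightarrow> f i \<in> carrier (F i)" by auto
  then show "ordered_product G \<phi> k f \<in> carrier G"
    using assms(1) hom_in_carrier by (metis ordered_product_closed)
next
  fix f g assume fg: "f \<in> carrier (product_group {..<k} F)" "g \<in> carrier (product_group {..<k} F)"
  have "ordered_product G \<phi> k (f \<otimes>\<^bsub>product_group {..<k} F\<^esub> g) = ordered_product G \<phi> k (\<lambda>i. f i \<otimes>\<^bsub>F i\<^esub> g i)"
    by (rule ordered_product_cong) simp
  also have "\<dots> = ordered_product G \<phi> k f \<otimes> ordered_product G \<phi> k g"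
    using assms fg by (intro ordered_product_mult) auto
  finally show "ordered_product G \<phi> k (f \<otimes>\<^bsub>product_group {..<k} F\<^esub> g) =
      ordered_product G \<phi> k f \<otimes> ordered_product G \<phi> k g" .
qed

section \<open>Homomorphisms from the dihedral group\<close>

definition dihedral_hom :: "('a, 'b) monoid_scheme \<Rightarrow> 'a \<Rightarrow> 'a \<Rightarrow> int \<times> int \<Rightarrow> 'a" where
  "dihedral_hom G r s = (\<lambda>(a, b). r [^]\<^bsub>G\<^esub> a \<otimes>\<^bsub>G\<^esub> s [^]\<^bsub>G\<^esub> b)"

text \<open>Multiplication in \<open>D8\<close> brings a product of two normal forms into normal
  form. The relation between \<open>s\<close> and \<open>r\<close> justifies the sign change of the
  second exponent, the other two relations the reductions modulo 4 and 2.\<close>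

lemma (in group) dihedral_hom:
  assumes r: "r \<in> carrier G" and s: "s \<in> carrier G"
    and r4: "r [^] (4::int) = \<one>" and s2: "s \<otimes> s = \<one>" and sr: "s \<otimes> r = inv r \<otimes> s"
  shows "dihedral_hom G r s \<in> hom D8 G"
proof (rule homI)
  fix p assume "p \<in> carrier D8" then show "dihedral_hom G r s p \<in> carrier G"
    using r s by (cases p) (simp add: dihedral_hom_def)
next
  fix p q assume pq: "p \<in> carrier D8" "q \<in> carrier D8"
  obtain a b a' b' where eq: "p = (a, b)" "q = (a', b')" by (metis surj_pair)
  have b: "b = 0 \<or> b = 1" "b' = 0 \<or> b' = 1" using pq eq by (auto simp: carrier_D8)
  have mod4: "r [^] (i mod 4) = r [^] i" for i :: int
  proof -
    have "int (ord r) dvd 4" using r4 r by (simp add: int_pow_eq_id)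
    then show ?thesis using dvd_trans[OF _ dvd_minus_mod[of 4 i]] by (simp add: int_pow_eq[OF r])
  qed
  have conj: "s \<otimes> r [^] (i::int) = r [^] (-i) \<otimes> s" for i
  proof -
    have "s \<otimes> r \<otimes> s = inv r"
      using r s sr s2 by (simp add: m_assoc)
    moreover have nat: "s \<otimes> r [^] n \<otimes> s = (s \<otimes> r \<otimes> s) [^] n" for n :: nat
    proof (induction n)
      case 0 then show ?case using s s2 by simp
    next
      case (Suc n)
      \<comment> \<open>Conjugation by \<open>s\<close> is multiplicative because
        \<open>s \<otimes> s = \<one>\<close> can be inserted between the factors.\<close>
      have "s \<otimes> (r [^] n \<otimes> r) \<otimes> s = (s \<otimes> r [^] n) \<otimes> (s \<otimes> s) \<otimes> (r \<otimes> s)"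
        using r s s2 by (simp add: m_assoc)
      also have "\<dots> = (s \<otimes> r [^] n \<otimes> s) \<otimes> (s \<otimes> r \<otimes> s)"
        using r s by (simp add: m_assoc)
      finally show ?case using Suc by simp
    qed
    ultimately have nat': "s \<otimes> r [^] n \<otimes> s = inv (r [^] n)" for n :: nat
      using r by (simp add: nat_pow_inv)
    then have int: "s \<otimes> r [^] i \<otimes> s = inv (r [^] i)"
    proof (cases i rule: int_cases2)
      case (nonneg n)
      then show ?thesis using nat' by (simp add: int_pow_int)
    next
      case (nonpos n)
      have "inv (s \<otimes> r [^] n \<otimes> s) = s \<otimes> inv (r [^] n) \<otimes> s"
        using r s s2 by (simp add: inv_mult_group m_assoc inv_equality[OF s2])
      then show ?thesis using nat'[of n] nonpos r by (simp add: int_pow_int int_pow_neg)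
    qed
    have "s \<otimes> r [^] i = s \<otimes> r [^] i \<otimes> (s \<otimes> s)" using r s s2 by simp
    also have "\<dots> = (s \<otimes> r [^] i \<otimes> s) \<otimes> s" using r s by (simp add: m_assoc)
    finally show ?thesis using int r by (simp add: int_pow_neg)
  qed
  have ss: "s \<otimes> (s \<otimes> x) = x" if "x \<in> carrier G" for x
    using s s2 that by (simp add: m_assoc[symmetric])
  show "dihedral_hom G r s (p \<otimes>\<^bsub>D8\<^esub> q) = dihedral_hom G r s p \<otimes> dihedral_hom G r s q"
    using b
  proof (elim disjE)
    assume "b = 1" "b' = 0"
    then show ?thesis using r s conj[of a']
      by (simp add: eq mult_D8 dihedral_hom_def mod4 m_assoc int_pow_mult[OF r, of a "-a'", simplified])
  next
    assume "b = 1" "b' = 1"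
    then show ?thesis using r s s2 conj[of a']
      by (simp add: eq mult_D8 dihedral_hom_def mod4 m_assoc ss int_pow_mult[OF r, of a "-a'", simplified])
         (simp add: m_assoc[symmetric], simp add: m_assoc)
  qed (use r s in \<open>simp_all add: eq mult_D8 dihedral_hom_def mod4 m_assoc int_pow_mult\<close>)
qed

text \<open>Commuting with the rotation \<open>(1, 0)\<close> excludes the reflections, and
  commuting with the reflection \<open>(0, 1)\<close> leaves only the even rotations.\<close>

lemma center_D8: "center D8 = {(0, 0), (2, 0)}"
proof
  show "center D8 \<subseteq> {(0, 0), (2, 0)}"
  proof
    fix p assume p: "p \<in> center D8"
    obtain a b where eq: "p = (a, b)" by (metis surj_pair)
    have "p \<otimes>\<^bsub>D8\<^esub> q = q \<otimes>\<^bsub>D8\<^esub> p" if "q \<in> carrier D8" for q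
      using p that by (simp add: center_def)
    from this[of "(1, 0)"] this[of "(0, 1)"]
    have "p \<otimes>\<^bsub>D8\<^esub> (1, 0) = (1, 0) \<otimes>\<^bsub>D8\<^esub> p" "p \<otimes>\<^bsub>D8\<^esub> (0, 1) = (0, 1) \<otimes>\<^bsub>D8\<^esub> p"
      by (simp_all add: carrier_D8)
    moreover have "a = 0 \<or> a = 1 \<or> a = 2 \<or> a = 3" "b = 0 \<or> b = 1"
      using p by (auto simp: eq center_def carrier_D8)
    ultimately show "p \<in> {(0, 0), (2, 0)}"
      by (elim disjE; simp add: eq mult_D8)
  qed
  show "{(0, 0), (2, 0)} \<subseteq> center D8"
    using central_involution_D8 group.is_monoid[OF group_D8]
    by (auto simp: central_involution_def center_def one_D8[symmetric])
qed

text \<open>Every nontrivial normal subgroup of \<open>D8\<close> contains the central involution,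
  so a kernel that avoids it is trivial.\<close>

lemma inj_on_hom_D8:
  assumes "group G" and h: "h \<in> hom D8 G" and ne: "h (2, 0) \<noteq> \<one>\<^bsub>G\<^esub>"
  shows "inj_on h (carrier D8)"
proof -
  interpret h: group_hom D8 G h
    using group_D8 assms by (simp add: group_hom_def group_hom_axioms_def)
  have "p = (0, 0)" if p: "p \<in> carrier D8" and 1: "h p = \<one>\<^bsub>G\<^esub>" for p
  proof -
    obtain a b where eq: "p = (a, b)" by (metis surj_pair)
    have "(1, 0) \<in> carrier D8" by (simp add: carrier_D8)
    \<comment> \<open>Two words in \<open>p\<close> that reach the central involution: the first
      equals \<open>(2, 0)\<close> when \<open>p\<close> is a reflection, the second when
      \<open>p\<close> is a rotation of order 4.\<close>
    then have "h ((1, 0) \<otimes>\<^bsub>D8\<^esub> p \<otimes>\<^bsub>D8\<^esub> inv\<^bsub>D8\<^esub> (1, 0) \<otimes>\<^bsub>D8\<^esub> p) = \<one>\<^bsub>G\<^esub>" "h (p \<otimes>\<^bsub>D8\<^esub> p) = \<one>\<^bsub>G\<^esub>"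
      using 1 p by (simp_all add: h.H.r_inv)
    then have "(1, 0) \<otimes>\<^bsub>D8\<^esub> p \<otimes>\<^bsub>D8\<^esub> inv\<^bsub>D8\<^esub> (1, 0) \<otimes>\<^bsub>D8\<^esub> p \<noteq> (2, 0)" "p \<otimes>\<^bsub>D8\<^esub> p \<noteq> (2, 0)" "p \<noteq> (2, 0)"
      using ne 1 by fastforce+
    moreover have "inv\<^bsub>D8\<^esub> (1, 0) = (3, 0)"
      by (simp add: inv_D8 carrier_D8)
    moreover have "a = 0 \<or> a = 1 \<or> a = 2 \<or> a = 3" "b = 0 \<or> b = 1"
      using p by (auto simp: eq carrier_D8)
    ultimately show ?thesis
      by (elim disjE; simp add: eq mult_D8)
  qed
  then have "kernel D8 G h \<subseteq> {\<one>\<^bsub>D8\<^esub>}"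
    unfolding kernel_def one_D8 by blast
  moreover have "\<one>\<^bsub>D8\<^esub> \<in> kernel D8 G h"
    by (simp add: kernel_def)
  ultimately have "kernel D8 G h = {\<one>\<^bsub>D8\<^esub>}"
    by blast
  then show ?thesis
    using h.inj_iff_trivial_ker by blast
qed

section \<open>Embedding the central product of a family\<close>

text \<open>Replacing the \<open>j\<close>-th map by the constant \<open>\<one>\<close> deletes the
  factor without renumbering the others. This isolates one coordinate, either to test it for
  centrality or to evaluate a product with a single nontrivial factor.\<close>

lemma (in group) ordered_product_extract:
  assumes "j < k" and "\<And>i. i < k \<Longrightarrow> \<phi> i (f i) \<in> carrier G"
    and "\<And>i. i < k \<Longrightarrow> i \<noteq> j \<Longrightarrow> \<phi> i (f i) \<otimes> \<phi> j (f j) = \<phi> j (f j) \<otimes> \<phi> i (f i)"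
  shows "ordered_product G \<phi> k f = ordered_product G (\<phi>(j := \<lambda>_. \<one>)) k f \<otimes> \<phi> j (f j)"
  using assms
proof (induction k)
  case (Suc k)
  have cl: "ordered_product G (\<phi>(j := \<lambda>_. \<one>)) k f \<in> carrier G"
    using Suc.prems by (intro ordered_product_closed) auto
  show ?case
  proof (cases "j = k")
    case True
    have "ordered_product G (\<phi>(j := \<lambda>_. \<one>)) k f = ordered_product G \<phi> k f"
      using True by (intro ordered_product_cong) auto
    then show ?thesis
      using cl by (simp only: True ordered_product.simps fun_upd_same r_one)
  next
    case False
    then have "ordered_product G \<phi> k f = ordered_product G (\<phi>(j := \<lambda>_. \<one>)) k f \<otimes> \<phi> j (f j)"
      using Suc.prems by (intro Suc.IH) auto
    moreover have "t \<otimes> \<phi> j (f j) \<otimes> \<phi> k (f k) = t \<otimes> \<phi> k (f k) \<otimes> \<phi> j (f j)" if "t \<in> carrier G" for t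
    proof -
      have "\<phi> k (f k) \<otimes> \<phi> j (f j) = \<phi> j (f j) \<otimes> \<phi> k (f k)"
        "\<phi> k (f k) \<in> carrier G" "\<phi> j (f j) \<in> carrier G"
        using Suc.prems False by auto
      then show ?thesis using that by (simp add: m_assoc)
    qed
    ultimately show ?thesis
      using cl False by (simp only: ordered_product.simps fun_upd_other[OF not_sym[OF False]])
  qed
qed simp

text \<open>Each coordinate \<open>e i\<close> contributes one \<open>c\<close>, and
  \<open>c\<close> has square \<open>\<one>\<close>, so only the parity of their number survives.
  This is the origin of the parity condition in \<open>amalgam\<close> and
  \<open>common_involution\<close>.\<close>

lemma (in group) ordered_product_involutions:
  assumes c: "central_involution G c" and e: "\<And>i. i < k \<Longrightarrow> e i \<noteq> \<one>\<^bsub>F i\<^esub>"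
    and one: "\<And>i. i < k \<Longrightarrow> \<phi> i \<one>\<^bsub>F i\<^esub> = \<one>" and \<phi>e: "\<And>i. i < k \<Longrightarrow> \<phi> i (e i) = c"
    and f: "\<And>i. i < k \<Longrightarrow> f i \<in> {\<one>\<^bsub>F i\<^esub>, e i}"
  shows "ordered_product G \<phi> k f = (if even (card {i \<in> {..<k}. f i = e i}) then \<one> else c)"
  using e one \<phi>e f
proof (induction k)
  case (Suc k)
  have "{i \<in> {..<Suc k}. f i = e i} =
      (if f k = e k then insert k {i \<in> {..<k}. f i = e i} else {i \<in> {..<k}. f i = e i})"
    by (auto simp: less_Suc_eq)
  then have "card {i \<in> {..<Suc k}. f i = e i} = card {i \<in> {..<k}. f i = e i} + (if f k = e k then 1 else 0)"
    by auto
  moreover have "\<phi> k (f k) = (if f k = e k then c else \<one>)"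
    using Suc.prems(2-4)[of k] by auto
  moreover have "ordered_product G \<phi> k f = (if even (card {i \<in> {..<k}. f i = e i}) then \<one> else c)"
    using Suc.prems by (intro Suc.IH) auto
  ultimately show ?case
    using central_involutionD(1,3)[OF c] by (simp del: even_add)
qed simp

text \<open>Centrality of the product forces each coordinate into the center of its factor, that is,
  to be \<open>\<one>\<close> or \<open>e i\<close>; parity then decides the value. This gives both
  the kernel and the bound on central elements of the image. With \<open>k = 0\<close> there is no
  odd product, hence the condition on the common involution.\<close>

lemma (in group) central_product_family_embedding:
  fixes F :: "nat \<Rightarrow> ('c, 'm) monoid_scheme"
  assumes c: "central_involution G c"
    and F: "\<And>i. i < k \<Longrightarrow> group (F i)"
    and e: "\<And>i. i < k \<Longrightarrow> central_involution (F i) (e i)"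
    and center: "\<And>i. i < k \<Longrightarrow> center (F i) = {\<one>\<^bsub>F i\<^esub>, e i}"
    and \<phi>: "\<And>i. i < k \<Longrightarrow> \<phi> i \<in> mon (F i) G" and \<phi>e: "\<And>i. i < k \<Longrightarrow> \<phi> i (e i) = c"
    and commute: "\<And>i j x y. i < k \<Longrightarrow> j < k \<Longrightarrow> i \<noteq> j \<Longrightarrow> x \<in> carrier (F i) \<Longrightarrow> y \<in> carrier (F j) \<Longrightarrow>
      \<phi> i x \<otimes> \<phi> j y = \<phi> j y \<otimes> \<phi> i x"
  obtains g where "g \<in> mon (central_product_family {..<k} F e) G"
    and "g ` carrier (central_product_family {..<k} F e) =
      ordered_product G \<phi> k ` carrier (product_group {..<k} F)"
    and "1 \<le> k \<Longrightarrow> g (common_involution {..<k} F e) = c"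
    and "g ` carrier (central_product_family {..<k} F e) \<inter> center G \<subseteq> {\<one>, c}"
proof -
  let ?P = "product_group {..<k} F" and ?A = "amalgam {..<k} F e" and ?T = "ordered_product G \<phi> k"
  have hyp: "finite {..<k}" "\<And>i. i \<in> {..<k} \<Longrightarrow> group (F i)" "\<And>i. i \<in> {..<k} \<Longrightarrow> central_involution (F i) (e i)"
    using F e by auto
  have hom: "\<phi> i \<in> hom (F i) G" "inj_on (\<phi> i) (carrier (F i))" if "i < k" for i
    using \<phi>[OF that] by (auto simp: mon_def)
  have cl: "\<phi> i x \<in> carrier G" if "i < k" "x \<in> carrier (F i)" for i x
    using hom(1) that hom_in_carrier by metis
  have one: "\<phi> i \<one>\<^bsub>F i\<^esub> = \<one>" if "i < k" for i
    using hom_one[OF hom(1)[OF that] F[OF that] is_group] .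
  have T: "?T \<in> hom ?P G"
    using hom commute by (intro ordered_product_hom)
  have P: "group ?P" using hyp(2) by (rule product_group)
  interpret A: normal ?A ?P by (rule amalgam_normal[OF hyp])
  have val: "?T f = (if even (card {i \<in> {..<k}. f i = e i}) then \<one> else c)"
    if "f \<in> (\<Pi>\<^sub>E i\<in>{..<k}. {\<one>\<^bsub>F i\<^esub>, e i})" for f
    using that central_involutionD(2)[OF e] by (intro ordered_product_involutions[OF c _ one \<phi>e]) auto
  \<comment> \<open>With factor \<open>j\<close> moved to the end, the remaining product
    \<open>u\<close> commutes with \<open>\<phi> j y\<close> and cancels. What is left is a
    commutation inside the image of \<open>\<phi> j\<close>, which injectivity carries back to
    \<open>F j\<close>.\<close>
  have central: "f \<in> (\<Pi>\<^sub>E i\<in>{..<k}. {\<one>\<^bsub>F i\<^esub>, e i})" if f: "f \<in> carrier ?P" and "?T f \<in> center G" for f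
  proof -
    have "f j \<in> {\<one>\<^bsub>F j\<^esub>, e j}" if j: "j < k" for j
    proof -
      have fi: "f i \<in> carrier (F i)" if "i < k" for i using f that by auto
      define u where "u = ordered_product G (\<phi>(j := \<lambda>_. \<one>)) k f"
      have u: "u \<in> carrier G"
        unfolding u_def using cl fi by (intro ordered_product_closed) auto
      have Tf: "?T f = u \<otimes> \<phi> j (f j)"
        unfolding u_def using j cl fi commute by (intro ordered_product_extract) auto
      have "f j \<otimes>\<^bsub>F j\<^esub> y = y \<otimes>\<^bsub>F j\<^esub> f j" if y: "y \<in> carrier (F j)" for y
      proof -
        have yu: "\<phi> j y \<otimes> u = u \<otimes> \<phi> j y"
          unfolding u_def using j cl fi commute y by (intro ordered_product_commute) auto
        have Fj: "\<phi> j y \<in> carrier G" "\<phi> j (f j) \<in> carrier G"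
          using cl fi j y by auto
        have "u \<otimes> \<phi> j (f j) \<otimes> \<phi> j y = \<phi> j y \<otimes> (u \<otimes> \<phi> j (f j))"
          using \<open>?T f \<in> center G\<close> Fj by (simp add: Tf center_def)
        also have "\<dots> = u \<otimes> (\<phi> j y \<otimes> \<phi> j (f j))"
          using yu u Fj by (metis m_assoc)
        finally have "\<phi> j (f j) \<otimes> \<phi> j y = \<phi> j y \<otimes> \<phi> j (f j)"
          using u Fj by (simp add: m_assoc)
        then have "\<phi> j (f j \<otimes>\<^bsub>F j\<^esub> y) = \<phi> j (y \<otimes>\<^bsub>F j\<^esub> f j)"
          using hom_mult[OF hom(1)[OF j]] fi[OF j] y by simp
        then show ?thesis
          using inj_onD[OF hom(2)[OF j]] fi[OF j] y monoid.m_closed[OF group.is_monoid[OF F[OF j]]] by metis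
      qed
      then show ?thesis
        using center[OF j] fi[OF j] by (auto simp: center_def)
    qed
    then show ?thesis using f by (auto simp: PiE_iff)
  qed
  have "kernel ?P G ?T = ?A"
  proof
    show "kernel ?P G ?T \<subseteq> ?A"
    proof
      fix f assume "f \<in> kernel ?P G ?T"
      then have f: "f \<in> carrier ?P" "?T f = \<one>" by (auto simp: kernel_def)
      \<comment> \<open>The identity is central, so elements of the kernel are covered by
        \<open>central\<close>.\<close>
      moreover have "\<one> \<in> center G" by (simp add: center_def)
      ultimately have "f \<in> (\<Pi>\<^sub>E i\<in>{..<k}. {\<one>\<^bsub>F i\<^esub>, e i})" using central by metis
      with val[OF this] f(2) central_involutionD(2)[OF c] show "f \<in> ?A"
        unfolding amalgam_def mem_Collect_eq by (simp split: if_splits)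
    qed
    show "?A \<subseteq> kernel ?P G ?T"
    proof
      fix f assume f: "f \<in> ?A"
      then have "f \<in> (\<Pi>\<^sub>E i\<in>{..<k}. {\<one>\<^bsub>F i\<^esub>, e i})" "even (card {i \<in> {..<k}. f i = e i})"
        by (simp_all only: amalgam_def mem_Collect_eq)
      then show "f \<in> kernel ?P G ?T"
        using val A.mem_carrier[OF f] by (simp only: kernel_def mem_Collect_eq if_True)
    qed
  qed
  then obtain g where g: "g \<in> mon (?P Mod ?A) G"
      and gT: "\<And>f. f \<in> carrier ?P \<Longrightarrow> g (?A #>\<^bsub>?P\<^esub> f) = ?T f"
    by (rule mon_FactGroup_lift[OF P is_group T A.normal_axioms]) blast
  have im: "g ` carrier (central_product_family {..<k} F e) = ?T ` carrier ?P"
    unfolding central_product_family_def carrier_FactGroup image_image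
    by (rule image_cong[OF refl gT])
  show thesis
  proof
    show "g (common_involution {..<k} F e) = c" if "1 \<le> k"
    proof -
      \<comment> \<open>A single \<open>e 0\<close> is the simplest odd product; the index
        \<open>0\<close> is available because \<open>1 \<le> k\<close>.\<close>
      define f where "f = (\<lambda>j\<in>{..<k}. if j = 0 then e 0 else \<one>\<^bsub>F j\<^esub>)"
      have f: "f \<in> common_involution {..<k} F e"
        unfolding f_def by (rule common_involution_nonempty) (use hyp that in simp_all)
      then have f': "f \<in> (\<Pi>\<^sub>E i\<in>{..<k}. {\<one>\<^bsub>F i\<^esub>, e i})" "odd (card {i \<in> {..<k}. f i = e i})"
        by (simp_all add: common_involution_def)
      have "f i \<in> carrier (F i)" if "i < k" for i
        using PiE_mem[OF f'(1), of i] that central_involutionD(1)[OF e[OF that]]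
          monoid.one_closed[OF group.is_monoid[OF F[OF that]]] by auto
      then have "f \<in> carrier ?P" using f'(1) by (auto simp: PiE_iff)
      moreover have "common_involution {..<k} F e = ?A #>\<^bsub>?P\<^esub> f"
        by (rule common_involution_coset) (use hyp f in simp_all)
      ultimately show ?thesis
        using gT val[OF f'(1)] f'(2) by simp
    qed
    show "g ` carrier (central_product_family {..<k} F e) \<inter> center G \<subseteq> {\<one>, c}"
      unfolding im
    proof
      fix x assume "x \<in> ?T ` carrier ?P \<inter> center G"
      then obtain f where "f \<in> carrier ?P" "x = ?T f" "?T f \<in> center G" by blast
      with val[OF central[OF this(1,3)]] show "x \<in> {\<one>, c}" by (simp split: if_splits)
    qed
  qed (use g im in \<open>simp_all only: central_product_family_def\<close>)
qed

section \<open>Splitting off dihedral subgroups\<close>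

text \<open>Iterating this gives the elements of \<open>S\<close> that commute with two generators.
  With the roles exchanged it shows that whatever commutes with the generators commutes with all
  they generate.\<close>

lemma (in group) subgroup_commuting:
  assumes "subgroup S G" and x: "x \<in> carrier G"
  shows "subgroup {s \<in> S. s \<otimes> x = x \<otimes> s} G"
proof (rule subgroupI)
  have S: "s \<in> S \<Longrightarrow> s \<in> carrier G" for s using subgroup.subset[OF assms(1)] by blast
  show "{s \<in> S. s \<otimes> x = x \<otimes> s} \<subseteq> carrier G" using S by blast
  show "{s \<in> S. s \<otimes> x = x \<otimes> s} \<noteq> {}"
    using subgroup.one_closed[OF assms(1)] x by force
  show "inv a \<in> {s \<in> S. s \<otimes> x = x \<otimes> s}" if "a \<in> {s \<in> S. s \<otimes> x = x \<otimes> s}" for a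
  proof -
    have a: "a \<in> carrier G" "a \<otimes> x = x \<otimes> a" "inv a \<in> S"
      using that S subgroup.m_inv_closed[OF assms(1)] by auto
    have "inv a \<otimes> x = inv a \<otimes> (x \<otimes> a) \<otimes> inv a" using a x by (simp add: m_assoc)
    also have "\<dots> = x \<otimes> inv a" using a x by (simp add: a(2)[symmetric] m_assoc[symmetric])
    finally show ?thesis using a by simp
  qed
  show "a \<otimes> b \<in> {s \<in> S. s \<otimes> x = x \<otimes> s}"
    if "a \<in> {s \<in> S. s \<otimes> x = x \<otimes> s}" "b \<in> {s \<in> S. s \<otimes> x = x \<otimes> s}" for a b
    using that S x commute_mult[of a b x] subgroup.m_closed[OF assms(1)] by simp
qed

lemma (in group) dihedral_hom_subgroup:
  assumes "subgroup S G" "r \<in> S" "s \<in> S"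
  shows "dihedral_hom G r s p \<in> S"
  using subgroup_int_pow_closed[OF assms(1)] subgroup.m_closed[OF assms(1)] assms(2,3)
  by (cases p) (simp add: dihedral_hom_def)

text \<open>The rotation is \<open>x \<otimes> y\<close> and the reflection is \<open>y\<close>.
  Since \<open>x\<close> and \<open>y\<close> have square \<open>\<one>\<close>, the inverse of the
  rotation is \<open>y \<otimes> x\<close>, so \<open>xy\<close> says that the square of the
  rotation is \<open>c\<close>.\<close>

lemma (in group) involutions_dihedral_hom:
  assumes c: "central_involution G c" and x: "x \<in> carrier G" "x \<otimes> x = \<one>"
    and y: "y \<in> carrier G" "y \<otimes> y = \<one>" and xy: "x \<otimes> y = c \<otimes> (y \<otimes> x)"
  shows "dihedral_hom G (x \<otimes> y) y \<in> hom D8 G" and "dihedral_hom G (x \<otimes> y) y (2, 0) = c"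
proof -
  note cD = central_involutionD[OF c]
  have "(x \<otimes> y) \<otimes> (x \<otimes> y) = (c \<otimes> (y \<otimes> x)) \<otimes> (x \<otimes> y)"
    by (rule arg_cong[OF xy, of "\<lambda>t. t \<otimes> (x \<otimes> y)"])
  also have "\<dots> = c \<otimes> (y \<otimes> ((x \<otimes> x) \<otimes> y))"
    using x(1) y(1) cD(1) by (simp add: m_assoc)
  finally have r2: "(x \<otimes> y) \<otimes> (x \<otimes> y) = c"
    using y cD(1) by (simp add: x(2))
  have "(x \<otimes> y) [^] (2::int) = (x \<otimes> y) \<otimes> (x \<otimes> y)"
    using x y int_pow_mult[of "x \<otimes> y" 1 1] by simp
  then have r2': "(x \<otimes> y) [^] (2::int) = c" using r2 by simp
  then show "dihedral_hom G (x \<otimes> y) y (2, 0) = c"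
    using cD(1) by (simp add: dihedral_hom_def)
  have "(x \<otimes> y) [^] (4::int) = \<one>"
    using x y int_pow_mult[of "x \<otimes> y" 2 2] r2' cD(3) by simp
  moreover have "inv (x \<otimes> y) = y \<otimes> x"
    using x y by (simp add: inv_mult_group inv_equality)
  ultimately show "dihedral_hom G (x \<otimes> y) y \<in> hom D8 G"
    using x y by (intro dihedral_hom) (simp_all add: m_assoc)
qed

text \<open>Moving \<open>x\<close> past \<open>b\<close> and then past \<open>a\<close> produces
  one \<open>c\<close> each time, and the two cancel.\<close>

lemma (in group) mult_commute_of_not_commute:
  assumes c: "central_involution G c"
    and comm: "\<forall>x \<in> carrier G. \<forall>y \<in> carrier G. x \<otimes> y = y \<otimes> x \<or> x \<otimes> y = c \<otimes> (y \<otimes> x)"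
    and x: "a \<in> carrier G" "b \<in> carrier G" "x \<in> carrier G" "a \<otimes> x \<noteq> x \<otimes> a" "b \<otimes> x \<noteq> x \<otimes> b"
  shows "(a \<otimes> b) \<otimes> x = x \<otimes> (a \<otimes> b)"
proof -
  have e: "a \<otimes> x = c \<otimes> (x \<otimes> a)" "b \<otimes> x = c \<otimes> (x \<otimes> b)"
    using comm x by blast+
  have "(a \<otimes> b) \<otimes> x = a \<otimes> (c \<otimes> (x \<otimes> b))"
    using x e by (simp add: m_assoc)
  also have "\<dots> = c \<otimes> ((a \<otimes> x) \<otimes> b)"
    using x central_involutionD(1)[OF c] central_involutionD(4)[OF c, of a] by (metis m_assoc m_closed)
  also have "\<dots> = (c \<otimes> c) \<otimes> (x \<otimes> (a \<otimes> b))"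
    using x central_involutionD(1)[OF c] by (simp add: e m_assoc)
  finally show ?thesis
    using x central_involutionD(3)[OF c] by simp
qed

text \<open>For fixed \<open>x\<close> the commutator with \<open>x\<close> is a homomorphism to the
  group of order 2 consisting of \<open>\<one>\<close> and \<open>c\<close>; this is its additivity,
  written with truth values.\<close>

lemma (in group) mult_centralizer:
  assumes c: "central_involution G c"
    and comm: "\<forall>x \<in> carrier G. \<forall>y \<in> carrier G. x \<otimes> y = y \<otimes> x \<or> x \<otimes> y = c \<otimes> (y \<otimes> x)"
    and x: "a \<in> carrier G" "b \<in> carrier G" "x \<in> carrier G"
  shows "(a \<otimes> b) \<otimes> x = x \<otimes> (a \<otimes> b) \<longleftrightarrow> (a \<otimes> x = x \<otimes> a \<longleftrightarrow> b \<otimes> x = x \<otimes> b)"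
proof (cases "a \<otimes> x = x \<otimes> a")
  case True
  have "(a \<otimes> b) \<otimes> x = x \<otimes> (a \<otimes> b) \<longleftrightarrow> a \<otimes> (b \<otimes> x) = a \<otimes> (x \<otimes> b)"
    using x True by (metis m_assoc)
  then show ?thesis using x True by simp
next
  case F: False
  show ?thesis
  proof (cases "b \<otimes> x = x \<otimes> b")
    case True
    have "(a \<otimes> b) \<otimes> x = x \<otimes> (a \<otimes> b) \<longleftrightarrow> (a \<otimes> x) \<otimes> b = (x \<otimes> a) \<otimes> b"
      using x True by (metis m_assoc)
    then show ?thesis using x True F by simp
  next
    case False
    then show ?thesis using mult_commute_of_not_commute[OF c comm x] F by simp
  qed
qed

text \<open>Whether an element commutes with \<open>x\<close> and with \<open>y\<close> gives four
  classes, and \<open>\<one>\<close>, \<open>x\<close>, \<open>y\<close>,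
  \<open>x \<otimes> y\<close> represent them all. Multiplying \<open>g\<close> by the
  representative of its own class makes it commute with both.\<close>

lemma (in group) dihedral_centralizer_factorization:
  assumes c: "central_involution G c"
    and comm: "\<forall>x \<in> carrier G. \<forall>y \<in> carrier G. x \<otimes> y = y \<otimes> x \<or> x \<otimes> y = c \<otimes> (y \<otimes> x)"
    and x: "x \<in> carrier G" "x \<otimes> x = \<one>" and y: "y \<in> carrier G" "y \<otimes> y = \<one>"
    and xy: "x \<otimes> y \<noteq> y \<otimes> x" and g: "g \<in> carrier G"
  obtains p where "p \<in> carrier D8"
    "(g \<otimes> dihedral_hom G (x \<otimes> y) y p) \<otimes> x = x \<otimes> (g \<otimes> dihedral_hom G (x \<otimes> y) y p)"
    "(g \<otimes> dihedral_hom G (x \<otimes> y) y p) \<otimes> y = y \<otimes> (g \<otimes> dihedral_hom G (x \<otimes> y) y p)"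
proof -
  let ?\<phi> = "dihedral_hom G (x \<otimes> y) y"
  \<comment> \<open>The four representatives as values on \<open>D8\<close>; \<open>(1, 1)\<close>
    gives \<open>x\<close> because the two factors \<open>y\<close> cancel.\<close>
  have \<phi>: "?\<phi> (0, 0) = \<one>" "?\<phi> (1, 0) = x \<otimes> y" "?\<phi> (0, 1) = y" "?\<phi> (1, 1) = x"
    using x y by (simp_all add: dihedral_hom_def m_assoc)
  note mc = mult_centralizer[OF c comm]
  have 1: "(g \<otimes> h) \<otimes> x = x \<otimes> (g \<otimes> h) \<longleftrightarrow> (g \<otimes> x = x \<otimes> g \<longleftrightarrow> h \<otimes> x = x \<otimes> h)"
    "(g \<otimes> h) \<otimes> y = y \<otimes> (g \<otimes> h) \<longleftrightarrow> (g \<otimes> y = y \<otimes> g \<longleftrightarrow> h \<otimes> y = y \<otimes> h)"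
    if "h \<in> carrier G" for h
    using mc[OF g that] x y by blast+
  have 2: "\<not> (x \<otimes> y) \<otimes> x = x \<otimes> (x \<otimes> y)" "\<not> (x \<otimes> y) \<otimes> y = y \<otimes> (x \<otimes> y)"
    using mc[OF x(1) y(1) x(1)] mc[OF x(1) y(1) y(1)] xy by auto
  consider "g \<otimes> x = x \<otimes> g" "g \<otimes> y = y \<otimes> g" | "g \<otimes> x = x \<otimes> g" "g \<otimes> y \<noteq> y \<otimes> g"
    | "g \<otimes> x \<noteq> x \<otimes> g" "g \<otimes> y = y \<otimes> g" | "g \<otimes> x \<noteq> x \<otimes> g" "g \<otimes> y \<noteq> y \<otimes> g"
    by blast
  then show thesis
  proof cases
    case 1 then show thesis using that[of "(0, 0)"] g by (simp add: \<phi> carrier_D8)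
  next
    case 2 then show thesis using that[of "(1, 1)"] 1[OF x(1)] xy by (simp only: \<phi>) (simp add: carrier_D8)
  next
    case 3 then show thesis using that[of "(0, 1)"] 1[OF y(1)] xy by (simp only: \<phi>) (simp add: carrier_D8)
  next
    case 4 then show thesis using that[of "(1, 0)"] 1[of "x \<otimes> y"] 2 x(1) y(1) by (simp only: \<phi>) (simp add: carrier_D8)
  qed
qed

text \<open>Induction over subgroups \<open>S\<close> that contain the center: the relative
  centralizer of two noncommuting elements is smaller, and still contains the center. The center is
  kept inside \<open>S\<close> so that the central corrections making squares trivial do not leave
  \<open>S\<close>. The factor \<open>w\<close> is only required to be central in \<open>S\<close>,
  which for \<open>S = carrier G\<close> means central in \<open>G\<close>.\<close>

lemma (in group) dihedral_decomposition:
  assumes fin: "finite (carrier G)" and c: "central_involution G c"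
    and comm: "\<forall>x \<in> carrier G. \<forall>y \<in> carrier G. x \<otimes> y = y \<otimes> x \<or> x \<otimes> y = c \<otimes> (y \<otimes> x)"
    and sq: "\<forall>x \<in> carrier G. \<exists>w \<in> center G. (x \<otimes> w) \<otimes> (x \<otimes> w) = \<one>"
    and "subgroup S G" and "center G \<subseteq> S"
  shows "\<exists>k \<phi>. (\<forall>i<k. \<phi> i \<in> hom D8 G \<and> \<phi> i (2, 0) = c \<and> \<phi> i ` carrier D8 \<subseteq> S) \<and>
    (\<forall>i<k. \<forall>j<k. i \<noteq> j \<longrightarrow> (\<forall>p\<in>carrier D8. \<forall>q\<in>carrier D8. \<phi> i p \<otimes> \<phi> j q = \<phi> j q \<otimes> \<phi> i p)) \<and>
    (\<forall>g\<in>S. \<exists>f\<in>carrier (product_group {..<k} (\<lambda>_. D8)). \<exists>w\<in>S.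
      (\<forall>s\<in>S. w \<otimes> s = s \<otimes> w) \<and> g = ordered_product G \<phi> k f \<otimes> w)"
  using assms(5,6)
proof (induction "card S" arbitrary: S rule: less_induct)
  case (less S)
  have SG: "s \<in> S \<Longrightarrow> s \<in> carrier G" for s using subgroup.subset[OF less.prems(1)] by blast
  show ?case
  proof (cases "\<forall>x\<in>S. \<forall>y\<in>S. x \<otimes> y = y \<otimes> x")
    case True
    \<comment> \<open>No dihedral factor is needed: with \<open>k = 0\<close> the ordered product is
      \<open>\<one>\<close> and \<open>w\<close> is \<open>g\<close> itself.\<close>
    show ?thesis
      by (rule exI[of _ 0]) (use True SG in auto)
  next
    case False
    then obtain x0 y0 where xy0: "x0 \<in> S" "y0 \<in> S" "x0 \<otimes> y0 \<noteq> y0 \<otimes> x0" by blast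
    obtain u v where uv: "u \<in> center G" "(x0 \<otimes> u) \<otimes> (x0 \<otimes> u) = \<one>" "v \<in> center G" "(y0 \<otimes> v) \<otimes> (y0 \<otimes> v) = \<one>"
      using sq SG xy0 by meson
    define x y where "x = x0 \<otimes> u" and "y = y0 \<otimes> v"
    have uvG: "u \<in> carrier G" "v \<in> carrier G" "u \<in> S" "v \<in> S"
      "\<And>t. t \<in> carrier G \<Longrightarrow> u \<otimes> t = t \<otimes> u" "\<And>t. t \<in> carrier G \<Longrightarrow> v \<otimes> t = t \<otimes> v"
      using uv less.prems(2) by (auto simp: center_def)
    have x: "x \<in> S" "x \<in> carrier G" "x \<otimes> x = \<one>" and y: "y \<in> S" "y \<in> carrier G" "y \<otimes> y = \<one>"
      using uv uvG xy0 SG subgroup.m_closed[OF less.prems(1)] by (auto simp: x_def y_def)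
    \<comment> \<open>A central factor commutes with everything, so by
      \<open>mult_centralizer\<close> the corrections \<open>u\<close> and \<open>v\<close> leave
      noncommutation intact.\<close>
    have ne: "x \<otimes> y \<noteq> y \<otimes> x"
    proof -
      have "x0 \<otimes> y \<noteq> y \<otimes> x0"
        using mult_centralizer[OF c comm, of y0 v x0] xy0 SG uvG by (metis y_def)
      then show ?thesis
        using mult_centralizer[OF c comm, of x0 u y] xy0 SG uvG y by (metis x_def)
    qed
    then have xy: "x \<otimes> y = c \<otimes> (y \<otimes> x)" using comm x y by blast
    let ?\<psi> = "dihedral_hom G (x \<otimes> y) y"
    have \<psi>: "?\<psi> \<in> hom D8 G" "?\<psi> (2, 0) = c"
      using involutions_dihedral_hom[OF c x(2,3) y(2,3) xy] by auto
    have \<psi>S: "?\<psi> p \<in> T" if "subgroup T G" "x \<in> T" "y \<in> T" for p T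
      using that by (intro dihedral_hom_subgroup subgroup.m_closed)
    have \<psi>c: "?\<psi> p \<in> carrier G" for p
      by (rule \<psi>S[OF subgroup_self x(2) y(2)])
    define S' where "S' = {s \<in> {s \<in> S. s \<otimes> x = x \<otimes> s}. s \<otimes> y = y \<otimes> s}"
    have S': "subgroup S' G"
      unfolding S'_def using less.prems(1) x y by (intro subgroup_commuting)
    have S'G: "s \<in> S' \<Longrightarrow> s \<in> carrier G" for s using SG by (simp add: S'_def)
    \<comment> \<open>The centralizer of \<open>s\<close> is a subgroup containing \<open>x\<close>
      and \<open>y\<close>, hence it contains every value of the dihedral homomorphism.\<close>
    have comm\<psi>: "s \<otimes> ?\<psi> p = ?\<psi> p \<otimes> s" if s: "s \<in> carrier G" "s \<otimes> x = x \<otimes> s" "s \<otimes> y = y \<otimes> s" for s p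
    proof -
      have "?\<psi> p \<in> {t \<in> carrier G. t \<otimes> s = s \<otimes> t}"
        using s x y by (intro \<psi>S subgroup_commuting subgroup_self) auto
      then show ?thesis by simp
    qed
    have "S' \<subset> S" using x ne by (auto simp: S'_def)
    moreover have "finite S" using fin subgroup.subset[OF less.prems(1)] finite_subset by blast
    ultimately have "card S' < card S" by (rule psubset_card_mono[rotated])
    moreover have "center G \<subseteq> S'"
      using less.prems(2) x y by (auto simp: S'_def center_def)
    ultimately obtain k \<phi> where H:
      "\<forall>i<k. \<phi> i \<in> hom D8 G \<and> \<phi> i (2, 0) = c \<and> \<phi> i ` carrier D8 \<subseteq> S'"
      "\<forall>i<k. \<forall>j<k. i \<noteq> j \<longrightarrow> (\<forall>p\<in>carrier D8. \<forall>q\<in>carrier D8. \<phi> i p \<otimes> \<phi> j q = \<phi> j q \<otimes> \<phi> i p)"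
      "\<forall>g\<in>S'. \<exists>f\<in>carrier (product_group {..<k} (\<lambda>_. D8)). \<exists>w\<in>S'.
        (\<forall>s\<in>S'. w \<otimes> s = s \<otimes> w) \<and> g = ordered_product G \<phi> k f \<otimes> w"
      using less.hyps[OF _ S'] by (elim meta_impE exE conjE)
    note \<phi>1 = H(1)[rule_format] and \<phi>2 = H(2)[rule_format] and \<phi>3 = H(3)[rule_format]
    have \<phi>\<psi>: "\<phi> i p \<otimes> ?\<psi> q = ?\<psi> q \<otimes> \<phi> i p" if "i < k" "p \<in> carrier D8" for i p q
    proof -
      have "\<phi> i p \<in> S'" using \<phi>1[OF that(1)] that(2) by blast
      then show ?thesis using S'G by (intro comm\<psi>) (auto simp: S'_def)
    qed
    have cover: "\<exists>f\<in>carrier (product_group {..<Suc k} (\<lambda>_. D8)). \<exists>w\<in>S.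
      (\<forall>s\<in>S. w \<otimes> s = s \<otimes> w) \<and> g = ordered_product G (\<phi>(k := ?\<psi>)) (Suc k) f \<otimes> w" if g: "g \<in> S" for g
    proof -
      \<comment> \<open>Stated for every \<open>s\<close> in \<open>S\<close>, since it is needed
        for \<open>g\<close> and again to show that \<open>w\<close> is central in
        \<open>S\<close>.\<close>
      have fact: "\<exists>p\<in>carrier D8. s \<otimes> ?\<psi> p \<in> S'" if s: "s \<in> S" for s
      proof -
        obtain p where p: "p \<in> carrier D8" "(s \<otimes> ?\<psi> p) \<otimes> x = x \<otimes> (s \<otimes> ?\<psi> p)"
          "(s \<otimes> ?\<psi> p) \<otimes> y = y \<otimes> (s \<otimes> ?\<psi> p)"
          using dihedral_centralizer_factorization[OF c comm x(2,3) y(2,3) ne SG[OF s]] by blast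
        moreover have "s \<otimes> ?\<psi> p \<in> S"
          using \<psi>S[OF less.prems(1) x(1) y(1)] subgroup.m_closed[OF less.prems(1) s] by blast
        ultimately show ?thesis by (auto simp: S'_def)
      qed
      obtain p where p: "p \<in> carrier D8" "g \<otimes> ?\<psi> p \<in> S'" using fact[OF g] by blast
      obtain f w where f: "f \<in> carrier (product_group {..<k} (\<lambda>_. D8))" and w: "w \<in> S'"
        "\<And>s. s \<in> S' \<Longrightarrow> w \<otimes> s = s \<otimes> w" and eq: "g \<otimes> ?\<psi> p = ordered_product G \<phi> k f \<otimes> w"
        using \<phi>3[OF p(2)] by blast
      \<comment> \<open>The correction is undone by the inverse of \<open>p\<close>, taken in
        \<open>D8\<close> so that it becomes the coordinate of the new factor.\<close>
      define q where "q = inv\<^bsub>D8\<^esub> p"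
      have q: "q \<in> carrier D8" "?\<psi> p \<otimes> ?\<psi> q = \<one>"
        using p group.inv_closed[OF group_D8] group.r_inv[OF group_D8] hom_mult[OF \<psi>(1), of p q]
          hom_one[OF \<psi>(1) group_D8 is_group] by (simp_all add: q_def)
      have wG: "w \<in> carrier G" "w \<otimes> x = x \<otimes> w" "w \<otimes> y = y \<otimes> w" "w \<in> S"
        using w(1) S'G by (auto simp: S'_def)
      have oG: "ordered_product G \<phi> k f \<in> carrier G"
      proof (rule ordered_product_closed)
        fix i assume "i < k"
        then show "\<phi> i (f i) \<in> carrier G"
          using \<phi>1 f hom_in_carrier[of "\<phi> i" D8 G "f i"] by auto
      qed
      have "g = (g \<otimes> ?\<psi> p) \<otimes> ?\<psi> q"
        using q SG[OF g] \<psi>c by (simp add: m_assoc)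
      also have "\<dots> = (ordered_product G \<phi> k f \<otimes> ?\<psi> q) \<otimes> w"
        using oG wG \<psi>c comm\<psi>[OF wG(1-3)] by (simp add: eq m_assoc)
      finally have "g = (ordered_product G \<phi> k f \<otimes> ?\<psi> q) \<otimes> w" .
      moreover have "ordered_product G (\<phi>(k := ?\<psi>)) k (f(k := q)) = ordered_product G \<phi> k f"
        by (rule ordered_product_cong) simp
      ultimately have "g = ordered_product G (\<phi>(k := ?\<psi>)) (Suc k) (f(k := q)) \<otimes> w"
        by simp
      moreover have "f(k := q) \<in> carrier (product_group {..<Suc k} (\<lambda>_. D8))"
        using f q(1) by (auto simp: PiE_iff extensional_def less_Suc_eq)
      \<comment> \<open>Centrality in \<open>S'\<close> extends to \<open>S\<close>:
        \<open>s\<close> differs from an element of \<open>S'\<close> by a dihedral value, and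
        \<open>w\<close> commutes with both.\<close>
      moreover have "w \<otimes> s = s \<otimes> w" if s: "s \<in> S" for s
      proof -
        obtain p where p: "p \<in> carrier D8" "s \<otimes> ?\<psi> p \<in> S'" using fact[OF s] by blast
        have "w \<otimes> s \<otimes> ?\<psi> p = s \<otimes> ?\<psi> p \<otimes> w"
          using w(2)[OF p(2)] wG SG[OF s] \<psi>c by (simp add: m_assoc)
        also have "\<dots> = s \<otimes> w \<otimes> ?\<psi> p"
          using comm\<psi>[OF wG(1-3), of p] wG SG[OF s] \<psi>c by (simp add: m_assoc)
        finally show ?thesis
          using wG SG[OF s] \<psi>c by simp
      qed
      ultimately show ?thesis using wG(4) by blast
    qed
    have "S' \<subseteq> S" by (auto simp: S'_def)
    have 1: "\<forall>i<Suc k. (\<phi>(k := ?\<psi>)) i \<in> hom D8 G \<and> (\<phi>(k := ?\<psi>)) i (2, 0) = c \<and>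
        (\<phi>(k := ?\<psi>)) i ` carrier D8 \<subseteq> S"
    proof (intro allI impI)
      fix i assume "i < Suc k"
      then consider "i = k" | "i \<noteq> k" "i < k" by linarith
      then show "(\<phi>(k := ?\<psi>)) i \<in> hom D8 G \<and> (\<phi>(k := ?\<psi>)) i (2, 0) = c \<and>
        (\<phi>(k := ?\<psi>)) i ` carrier D8 \<subseteq> S"
      proof cases
        case 1
        then show ?thesis using \<psi> \<psi>S[OF less.prems(1) x(1) y(1)] by (simp add: image_subset_iff)
      next
        case 2
        then show ?thesis using \<phi>1[OF 2(2)] \<open>S' \<subseteq> S\<close> by (simp only: fun_upd_other[OF 2(1)]) blast
      qed
    qed
    have 2: "\<forall>i<Suc k. \<forall>j<Suc k. i \<noteq> j \<longrightarrow> (\<forall>p\<in>carrier D8. \<forall>q\<in>carrier D8.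
        (\<phi>(k := ?\<psi>)) i p \<otimes> (\<phi>(k := ?\<psi>)) j q = (\<phi>(k := ?\<psi>)) j q \<otimes> (\<phi>(k := ?\<psi>)) i p)"
    proof (intro allI impI ballI)
      fix i j p q assume ij: "i < Suc k" "j < Suc k" "i \<noteq> j" "p \<in> carrier D8" "q \<in> carrier D8"
      then consider "i = k" "j \<noteq> k" "j < k" | "i \<noteq> k" "i < k" "j = k" | "i \<noteq> k" "i < k" "j \<noteq> k" "j < k" by linarith
      then show "(\<phi>(k := ?\<psi>)) i p \<otimes> (\<phi>(k := ?\<psi>)) j q = (\<phi>(k := ?\<psi>)) j q \<otimes> (\<phi>(k := ?\<psi>)) i p"
      proof cases
        case 1
        then show ?thesis using \<phi>\<psi>[OF 1(3) ij(5), of p] by simp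
      next
        case 2
        then show ?thesis using \<phi>\<psi>[OF 2(2) ij(4), of q] by simp
      next
        case 3
        then show ?thesis using \<phi>2[OF 3(2,4) ij(3-5)] by simp
      qed
    qed
    show ?thesis
      using 1 2 cover by (intro exI[of _ "Suc k"] exI[of _ "\<phi>(k := ?\<psi>)"] conjI ballI)
  qed
qed

section \<open>Cyclic subgroups, the center and independence\<close>

lemma (in group) int_pow_mod_hom:
  assumes x: "x \<in> carrier G" and "ord x dvd q"
  shows "(\<lambda>i::int. x [^] i) \<in> hom (integer_mod_group q) G"
proof (rule homI)
  fix i j :: int
  have "x [^] ((i + j) mod int q) = x [^] (i + j)"
    using dvd_trans[OF _ dvd_minus_mod[of "int q" "i + j"]] assms(2)
    by (simp add: int_pow_eq[OF x])
  then show "x [^] (i \<otimes>\<^bsub>integer_mod_group q\<^esub> j) = x [^] i \<otimes> x [^] j"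
    using x by (simp add: int_pow_mult)
qed (use x in simp)

lemma (in group) int_pow_eq_one_mod:
  assumes "x \<in> carrier G" and "ord x = q" and "q \<noteq> 0" and "i \<in> carrier (integer_mod_group q)" and "x [^] i = \<one>"
  shows "i = 0"
proof -
  have "0 \<le> i" "i < int q" "int q dvd i"
    using assms by (auto simp: int_pow_eq_id carrier_integer_mod_group)
  then show ?thesis using zdvd_not_zless[of i "int q"] by linarith
qed

lemma (in group) generate_one_or_involution:
  assumes "c \<in> carrier G" and "c \<otimes> c = \<one>"
  shows "generate G {c} \<subseteq> {\<one>, c}"
proof (rule generate_subgroup_incl)
  show "subgroup {\<one>, c} G"
    by (rule subgroupI) (use assms in \<open>auto simp: inv_equality\<close>)
qed simp

text \<open>A cyclic 2-group has only one involution: if \<open>c\<close> is the \<open>k\<close>-th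
  power, then \<open>2 ^ (n + 1)\<close> divides \<open>2 * k\<close> but not \<open>k\<close>, so
  \<open>k\<close> is an odd multiple of \<open>2 ^ n\<close>, which agrees with
  \<open>2 ^ n\<close> modulo the order.\<close>

lemma (in group) involution_generate_pow:
  assumes x: "x \<in> carrier G" and ord: "ord x = 2 ^ (n + 1)" and c: "c \<in> generate G {x}" "c \<noteq> \<one>" "c \<otimes> c = \<one>"
  shows "x [^] ((2::int) ^ n) = c"
proof -
  obtain k :: int where k: "c = x [^] k"
    using c(1) generate_pow[OF x] by auto
  have "x [^] (2 * k) = \<one>" using c(3) int_pow_mult[OF x, of k k] by (simp add: k)
  then have "(2::int) * 2 ^ n dvd 2 * k" using ord x by (simp add: int_pow_eq_id)
  then obtain j where j: "k = 2 ^ n * j" by (auto elim: dvdE)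
  have "\<not> (2::int) * 2 ^ n dvd k" using c(2) ord x by (simp add: k int_pow_eq_id)
  then have "odd j" by (auto simp: j elim!: evenE)
  then obtain i where "j = 2 * i + 1" by (elim oddE)
  then have "k - 2 ^ n = (2 * 2 ^ n) * i" by (simp add: j algebra_simps)
  then have "2 * 2 ^ n dvd k - 2 ^ n" by simp
  then show ?thesis using ord x by (simp add: k int_pow_eq)
qed

lemma (in group) subgroup_center: "subgroup (center G) G"
proof (rule subgroupI)
  show "inv a \<in> center G" if "a \<in> center G" for a
  proof -
    have a: "a \<in> carrier G" and "\<And>y. y \<in> carrier G \<Longrightarrow> a \<otimes> y = y \<otimes> a"
      using that by (auto simp: center_def)
    have "inv a \<in> {s \<in> carrier G. s \<otimes> y = y \<otimes> s}" if "y \<in> carrier G" for y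
      using subgroup.m_inv_closed[OF subgroup_commuting[OF subgroup_self that], of a] \<open>a \<in> center G\<close> that
      by (simp add: center_def)
    then show ?thesis using a by (simp add: center_def)
  qed
  show "a \<otimes> b \<in> center G" if "a \<in> center G" "b \<in> center G" for a b
  proof -
    have "a \<in> carrier G" "b \<in> carrier G" using that by (simp_all add: center_def)
    moreover have "y \<otimes> (a \<otimes> b) = (a \<otimes> b) \<otimes> y" if "y \<in> carrier G" for y
      using that \<open>a \<in> center G\<close> \<open>b \<in> center G\<close> by (intro commute_mult) (simp_all add: center_def)
    ultimately show ?thesis by (simp add: center_def)
  qed
  have "\<one> \<in> center G" by (simp add: center_def)
  then show "center G \<noteq> {}" by blast
qed (auto simp: center_def)

text \<open>Here \<open>u\<close> is the inverse of \<open>v\<close> and so lies in the trivial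
  intersection. This form allows the factors of a product equal to \<open>\<one>\<close> to be
  peeled off one by one.\<close>

lemma (in group) independent_mult:
  assumes "\<And>i. i \<in> I \<Longrightarrow> H i \<subseteq> carrier G"
    and "i \<in> I" and "H i \<inter> generate G (\<Union>j \<in> I - {i}. H j) = {\<one>}"
    and u: "u \<in> H i" and v: "v \<in> generate G (\<Union>j \<in> I - {i}. H j)" and uv: "u \<otimes> v = \<one>"
  shows "u = \<one>" and "v = \<one>"
proof -
  have sub: "(\<Union>j \<in> I - {i}. H j) \<subseteq> carrier G" using assms(1) by blast
  have vG: "v \<in> carrier G" using generate_in_carrier[OF sub v] .
  have uG: "u \<in> carrier G" using assms(1,2) u by blast
  have "u = inv v" using uv uG vG by (simp add: inv_equality)
  then have "u \<in> generate G (\<Union>j \<in> I - {i}. H j)" using generate_m_inv_closed[OF sub v] by simp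
  then show "u = \<one>" using u assms(3) by blast
  then show "v = \<one>" using uv vG by simp
qed

section \<open>Gluing two commuting factors\<close>

text \<open>If \<open>f x \<otimes> g y = \<one>\<close>, then \<open>f x\<close> lies in both
  images, so \<open>x\<close> is \<open>\<one>\<close> or \<open>e\<close> by injectivity, and
  \<open>y\<close> is correspondingly \<open>\<one>\<close> or \<open>d\<close>. The kernel is thus
  exactly the subgroup factored out.\<close>

lemma (in group) central_product_embedding:
  assumes H: "group H" and K: "group K" and e: "central_involution H e" and d: "central_involution K d"
    and f: "f \<in> mon H G" and g: "g \<in> mon K G"
    and commute: "\<And>x y. x \<in> carrier H \<Longrightarrow> y \<in> carrier K \<Longrightarrow> f x \<otimes> g y = g y \<otimes> f x"
    and fg: "f e = g d" and int: "f ` carrier H \<inter> g ` carrier K \<subseteq> {\<one>, f e}"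
  obtains h where "h \<in> mon (central_product H e K d) G"
    and "h ` carrier (central_product H e K d) = (\<lambda>(x, y). f x \<otimes> g y) ` (carrier H \<times> carrier K)"
proof -
  let ?h = "\<lambda>(x, y). f x \<otimes> g y" and ?U = "{(\<one>\<^bsub>H\<^esub>, \<one>\<^bsub>K\<^esub>), (e, d)}"
  have fh: "f \<in> hom H G" "inj_on f (carrier H)" and gh: "g \<in> hom K G" "inj_on g (carrier K)"
    using f g by (auto simp: mon_def)
  interpret f: group_hom H G f using H is_group fh by (simp add: group_hom_def group_hom_axioms_def)
  interpret g: group_hom K G g using K is_group gh by (simp add: group_hom_def group_hom_axioms_def)
  note eD = central_involutionD(1-3)[OF e] and dD = central_involutionD(1-3)[OF d]
  have h: "?h \<in> hom (H \<times>\<times> K) G" using fh(1) gh(1) commute by (rule hom_DirProd_mult)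
  have ker: "kernel (H \<times>\<times> K) G ?h = ?U"
  proof
    show "kernel (H \<times>\<times> K) G ?h \<subseteq> ?U"
    proof
      fix p assume "p \<in> kernel (H \<times>\<times> K) G ?h"
      then obtain x y where p: "p = (x, y)" and xy: "x \<in> carrier H" "y \<in> carrier K" and "f x \<otimes> g y = \<one>"
        by (auto simp: kernel_def)
      then have x: "f x = g (inv\<^bsub>K\<^esub> y)" by (simp add: inv_equality)
      then have "f x \<in> f ` carrier H \<inter> g ` carrier K"
        using imageI[OF xy(1), of f] imageI[OF group.inv_closed[OF K xy(2)], of g] by (simp only: x Int_iff)
      then have "f x = \<one> \<or> f x = f e" using int by blast
      then consider "x = \<one>\<^bsub>H\<^esub>" | "x = e"
        using inj_onD[OF fh(2)] xy eD f.hom_one by (metis f.G.one_closed)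
      then show "p \<in> ?U"
      proof cases
        case 1
        then have "g y = g \<one>\<^bsub>K\<^esub>" using \<open>f x \<otimes> g y = \<one>\<close> xy by simp
        then show ?thesis using inj_onD[OF gh(2)] xy 1 p by simp
      next
        case 2
        then have "g d \<otimes> g y = g d \<otimes> g d"
          using \<open>f x \<otimes> g y = \<one>\<close> dD g.hom_mult[of d d] fg by simp
        then have "g y = g d" using xy dD by simp
        then show ?thesis using inj_onD[OF gh(2)] xy dD 2 p by simp
      qed
    qed
    have "f e \<otimes> g d = \<one>" using dD g.hom_mult[of d d] fg by simp
    then show "?U \<subseteq> kernel (H \<times>\<times> K) G ?h"
      using eD dD by (auto simp: kernel_def)
  qed
  obtain h where h': "h \<in> mon ((H \<times>\<times> K) Mod ?U) G"
    and hh: "\<And>p. p \<in> carrier (H \<times>\<times> K) \<Longrightarrow> h (?U #>\<^bsub>H \<times>\<times> K\<^esub> p) = ?h p"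
    using mon_FactGroup_lift[OF DirProd_group[OF H K] is_group h central_product_normal[OF H K e d] ker] by blast
  have "h ` carrier ((H \<times>\<times> K) Mod ?U) = ?h ` carrier (H \<times>\<times> K)"
    unfolding carrier_FactGroup image_image by (rule image_cong[OF refl hh])
  then show thesis
    using that[of h] h' by (simp add: central_product_def)
qed

text \<open>The same kernel argument with trivial intersection, where nothing has to be factored
  out.\<close>

lemma (in group) DirProd_iso:
  assumes H: "group H" and K: "group K"
    and f: "f \<in> mon H G" and g: "g \<in> mon K G"
    and commute: "\<And>x y. x \<in> carrier H \<Longrightarrow> y \<in> carrier K \<Longrightarrow> f x \<otimes> g y = g y \<otimes> f x"
    and int: "f ` carrier H \<inter> g ` carrier K \<subseteq> {\<one>}"
    and onto: "carrier G \<subseteq> (\<lambda>(x, y). f x \<otimes> g y) ` (carrier H \<times> carrier K)"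
  shows "H \<times>\<times> K \<cong> G"
proof -
  let ?h = "\<lambda>(x, y). f x \<otimes> g y"
  have fh: "f \<in> hom H G" "inj_on f (carrier H)" and gh: "g \<in> hom K G" "inj_on g (carrier K)"
    using f g by (auto simp: mon_def)
  interpret f: group_hom H G f using H is_group fh by (simp add: group_hom_def group_hom_axioms_def)
  interpret g: group_hom K G g using K is_group gh by (simp add: group_hom_def group_hom_axioms_def)
  have h: "?h \<in> hom (H \<times>\<times> K) G" using fh(1) gh(1) commute by (rule hom_DirProd_mult)
  interpret h: group_hom "H \<times>\<times> K" G ?h
    using DirProd_group[OF H K] is_group h by (simp add: group_hom_def group_hom_axioms_def)
  have "p = (\<one>\<^bsub>H\<^esub>, \<one>\<^bsub>K\<^esub>)" if "p \<in> kernel (H \<times>\<times> K) G ?h" for p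
  proof -
    obtain x y where p: "p = (x, y)" and xy: "x \<in> carrier H" "y \<in> carrier K" and eq: "f x \<otimes> g y = \<one>"
      using \<open>p \<in> kernel (H \<times>\<times> K) G ?h\<close> by (auto simp: kernel_def)
    then have x: "f x = g (inv\<^bsub>K\<^esub> y)" by (simp add: inv_equality)
    then have "f x \<in> f ` carrier H \<inter> g ` carrier K"
      using imageI[OF xy(1), of f] imageI[OF group.inv_closed[OF K xy(2)], of g] by (simp only: x Int_iff)
    then have 1: "f x = f \<one>\<^bsub>H\<^esub>" using int by auto
    then have "g y = g \<one>\<^bsub>K\<^esub>" using eq xy by simp
    then show ?thesis using inj_onD[OF gh(2)] inj_onD[OF fh(2) 1] xy p by simp
  qed
  moreover have "(\<one>\<^bsub>H\<^esub>, \<one>\<^bsub>K\<^esub>) \<in> kernel (H \<times>\<times> K) G ?h" by (simp add: kernel_def)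
  ultimately have "kernel (H \<times>\<times> K) G ?h = {\<one>\<^bsub>H \<times>\<times> K\<^esub>}" unfolding one_DirProd by blast
  then have "inj_on ?h (carrier (H \<times>\<times> K))" using h.inj_iff_trivial_ker by blast
  moreover have "?h ` carrier (H \<times>\<times> K) = carrier G" using onto by auto
  ultimately have "?h \<in> iso (H \<times>\<times> K) G" using h by (simp add: iso_def bij_betw_def)
  then show ?thesis by (rule is_isoI)
qed

section \<open>Coordinates on the center\<close>

text \<open>The center is split into the part \<open>\<alpha>\<close> of the two long cyclic
  factors, which takes part in the central product, and the part \<open>\<beta>\<close> of the
  remaining involutions, which becomes the direct factor. The shift by 3 matches coordinates counted
  from 0 with generators whose first two are \<open>z 1\<close> and \<open>z 2\<close>.\<close>

lemma (in group) center_decomposition: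
  fixes z :: "nat \<Rightarrow> 'a" and p q r :: nat
  assumes idp: "internal_direct_product G (center G) {1..r} (\<lambda>i. generate G {z i})"
    and r: "2 \<le> r" and z: "\<And>i. i \<in> {1..r} \<Longrightarrow> z i \<in> carrier G"
    and p: "ord (z 1) = p" "1 < p" and q: "ord (z 2) = q" "1 < q"
    and two: "\<And>i. i \<in> {3..r} \<Longrightarrow> ord (z i) = 2"
  defines "A \<equiv> integer_mod_group p \<times>\<times> integer_mod_group q"
    and "B \<equiv> product_group {..<r - 2} (\<lambda>_. integer_mod_group 2)"
    and "\<alpha> \<equiv> \<lambda>(a, b). z 1 [^] (a::int) \<otimes> z 2 [^] (b::int)"
    and "\<beta> \<equiv> ordered_product G (\<lambda>i e. z (i + 3) [^] (e::int)) (r - 2)"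
  shows "\<alpha> \<in> mon A G" and "\<beta> \<in> mon B G"
    and "\<alpha> ` carrier A \<inter> \<beta> ` carrier B \<subseteq> {\<one>}"
    and "center G = (\<lambda>(x, y). \<alpha> x \<otimes> \<beta> y) ` (carrier A \<times> carrier B)"
    and "\<alpha> ` carrier A \<subseteq> center G" and "\<beta> ` carrier B \<subseteq> center G"
proof -
  define H where "H = (\<lambda>i. generate G {z i})"
  have K: "center G = generate G (\<Union>i\<in>{1..r}. H i)"
    and ind: "\<And>i. i \<in> {1..r} \<Longrightarrow> H i \<inter> generate G (\<Union>j \<in> {1..r} - {i}. H j) = {\<one>}"
    using idp by (simp_all add: internal_direct_product_def H_def)
  have HG: "H i \<subseteq> carrier G" if "i \<in> {1..r}" for i
    using generate_incl[of "{z i}"] z[OF that] by (simp add: H_def)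
  have pow: "z i [^] (a::int) \<in> H i" if "i \<in> {1..r}" for i a
    using generate_pow[OF z[OF that]] by (auto simp: H_def)
  have gen: "subgroup (generate G (\<Union>j \<in> J. H j)) G" "i \<in> J \<Longrightarrow> H i \<subseteq> generate G (\<Union>j \<in> J. H j)"
    if "J \<subseteq> {1..r}" for J i
  proof -
    show "subgroup (generate G (\<Union>j \<in> J. H j)) G"
      using HG that by (intro generate_is_subgroup) blast
    show "i \<in> J \<Longrightarrow> H i \<subseteq> generate G (\<Union>j \<in> J. H j)"
      by (auto intro: generate.incl)
  qed
  have powc: "z i [^] (a::int) \<in> center G" if "i \<in> {1..r}" for i a
    using gen(2)[of "{1..r}" i] pow[OF that] that K by blast
  have comm: "x \<otimes> y = y \<otimes> x" if "x \<in> center G" "y \<in> carrier G" for x y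
    using that by (simp add: center_def)
  have cG: "x \<in> carrier G" if "x \<in> center G" for x
    using that by (simp add: center_def)
  have i3: "i + 3 \<in> {1..r}" "i + 3 \<in> {3..r}" if "i < r - 2" for i
    using that by auto
  have 12: "1 \<in> {1..r}" "2 \<in> {1..r}" using r by auto
  have \<alpha>c: "\<alpha> x \<in> center G" for x
    using subgroup.m_closed[OF subgroup_center] powc[OF 12(1)] powc[OF 12(2)] by (cases x) (simp add: \<alpha>_def)
  have \<beta>c: "ordered_product G (\<lambda>i e. z (i + 3) [^] (e::int)) l x \<in> center G" if "l \<le> r - 2" for l x
    using that by (intro ordered_product_mem_subgroup subgroup_center powc i3) simp
  then have \<beta>c': "\<beta> x \<in> center G" for x by (simp add: \<beta>_def)
  show "\<alpha> ` carrier A \<subseteq> center G" "\<beta> ` carrier B \<subseteq> center G"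
    using \<alpha>c \<beta>c' by blast+
  have \<alpha>: "\<alpha> \<in> hom A G"
    unfolding \<alpha>_def A_def
    using p q z 12 by (intro hom_DirProd_mult int_pow_mod_hom comm powc) simp_all
  have \<beta>: "\<beta> \<in> hom B G"
    unfolding \<beta>_def B_def
  proof (rule ordered_product_hom)
    fix i assume "i < r - 2"
    then show "(\<lambda>e. z (i + 3) [^] (e::int)) \<in> hom (integer_mod_group 2) G"
      using two[OF i3(2)] z[OF i3(1)] by (intro int_pow_mod_hom) simp_all
  next
    fix i j and x y :: int assume "i < r - 2" "j < r - 2"
    then show "z (i + 3) [^] x \<otimes> z (j + 3) [^] y = z (j + 3) [^] y \<otimes> z (i + 3) [^] x"
      by (intro comm powc int_pow_closed z i3)
  qed
  have A: "group A" unfolding A_def by (intro DirProd_group group_integer_mod_group)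
  have B: "group B" unfolding B_def by (intro product_group group_integer_mod_group)
  let ?h = "\<lambda>(x, y). \<alpha> x \<otimes> \<beta> y"
  have hom: "?h \<in> hom (A \<times>\<times> B) G"
    using \<alpha> \<beta> by (rule hom_DirProd_mult) (intro comm \<alpha>c cG \<beta>c')
  interpret h: group_hom "A \<times>\<times> B" G ?h
    using DirProd_group[OF A B] is_group hom by (simp add: group_hom_def group_hom_axioms_def)
  \<comment> \<open>The last factor is peeled off first, because the recursion of
    \<open>ordered_product\<close> exposes it.\<close>
  have ordered: "\<forall>i<l. z (i + 3) [^] e i = \<one>"
    if "l \<le> r - 2" "ordered_product G (\<lambda>i e. z (i + 3) [^] (e::int)) l e = \<one>" for l e
    using that
  proof (induction l)
    case (Suc l)
    let ?u = "z (l + 3) [^] e l" and ?v = "ordered_product G (\<lambda>i e. z (i + 3) [^] (e::int)) l e"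
    have l: "l + 3 \<in> {1..r}" "l < r - 2" using Suc.prems(1) by auto
    have "?v \<in> generate G (\<Union>j \<in> {1..r} - {l + 3}. H j)"
    proof (rule ordered_product_mem_subgroup)
      fix i assume "i < l"
      then have "i + 3 \<in> {1..r} - {l + 3}" using Suc.prems(1) by auto
      then show "z (i + 3) [^] e i \<in> generate G (\<Union>j \<in> {1..r} - {l + 3}. H j)"
        using gen(2)[of "{1..r} - {l + 3}" "i + 3"] pow[of "i + 3"] by blast
    qed (rule gen, blast)
    moreover have "?u \<otimes> ?v = \<one>"
      using Suc.prems comm[OF powc[OF l(1)] cG[OF \<beta>c], of l] by simp
    ultimately have "?u = \<one>" "?v = \<one>"
      using independent_mult[where H = H and I = "{1..r}", OF HG l(1) ind[OF l(1)] pow[OF l(1)]] by blast+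
    then show ?case using Suc by (auto simp: less_Suc_eq)
  qed simp
  have ker: "x = \<one>\<^bsub>A\<^esub> \<and> e = \<one>\<^bsub>B\<^esub>" if x: "x \<in> carrier A" and e: "e \<in> carrier B" and 1: "\<alpha> x \<otimes> \<beta> e = \<one>" for x e
  proof -
    obtain a b where x': "x = (a, b)" and ab: "a \<in> carrier (integer_mod_group p)" "b \<in> carrier (integer_mod_group q)"
      using x by (auto simp: A_def)
    \<comment> \<open>The indices occurring in \<open>\<beta>\<close> start at 3, so its values
      avoid the generators \<open>z 1\<close> and \<open>z 2\<close>, which are the ones split off
      next.\<close>
    have \<beta>gen: "\<beta> e \<in> generate G (\<Union>j \<in> {1..r} - {i}. H j)" if "i < 3" for i
      unfolding \<beta>_def
    proof (rule ordered_product_mem_subgroup)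
      fix j assume "j < r - 2"
      then have "j + 3 \<in> {1..r} - {i}" using that by auto
      then show "z (j + 3) [^] e j \<in> generate G (\<Union>j \<in> {1..r} - {i}. H j)"
        using gen(2)[of "{1..r} - {i}" "j + 3"] pow[of "j + 3"] by blast
    qed (rule gen, blast)
    have "z 2 [^] b \<in> generate G (\<Union>j \<in> {1..r} - {1}. H j)"
      using gen(2)[of "{1..r} - {1}" 2] pow[OF 12(2), of b] 12 by auto
    then have "z 2 [^] b \<otimes> \<beta> e \<in> generate G (\<Union>j \<in> {1..r} - {1}. H j)"
      using \<beta>gen[of 1] by (intro generate.eng) auto
    moreover have "z 1 [^] a \<otimes> (z 2 [^] b \<otimes> \<beta> e) = \<one>"
      using 1 z[OF 12(1)] z[OF 12(2)] cG[OF \<beta>c'] by (simp add: x' \<alpha>_def m_assoc)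
    ultimately have 2: "z 1 [^] a = \<one>" "z 2 [^] b \<otimes> \<beta> e = \<one>"
      using independent_mult[where H = H and I = "{1..r}", OF HG 12(1) ind[OF 12(1)] pow[OF 12(1)]] by blast+
    then have 3: "z 2 [^] b = \<one>" "\<beta> e = \<one>"
      using independent_mult[where H = H and I = "{1..r}", OF HG 12(2) ind[OF 12(2)] pow[OF 12(2)] \<beta>gen] by auto
    have "a = 0" using int_pow_eq_one_mod[OF z[OF 12(1)] p(1) _ ab(1) 2(1)] p(2) by simp
    moreover have "b = 0" using int_pow_eq_one_mod[OF z[OF 12(2)] q(1) _ ab(2) 3(1)] q(2) by simp
    moreover have "e i = 0" if i: "i < r - 2" for i
    proof (rule int_pow_eq_one_mod[OF z[OF i3(1)[OF i]] two[OF i3(2)[OF i]]])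
      show "e i \<in> carrier (integer_mod_group 2)" using e i by (auto simp: B_def)
      show "z (i + 3) [^] e i = \<one>" using ordered[OF order_refl] 3(2) i by (simp add: \<beta>_def)
    qed simp
    ultimately show ?thesis
      using e by (auto simp: x' A_def B_def fun_eq_iff PiE_iff extensional_def)
  qed
  have "kernel (A \<times>\<times> B) G ?h \<subseteq> {\<one>\<^bsub>A \<times>\<times> B\<^esub>}"
  proof
    fix w assume "w \<in> kernel (A \<times>\<times> B) G ?h"
    then obtain x e where "w = (x, e)" "x \<in> carrier A" "e \<in> carrier B" "\<alpha> x \<otimes> \<beta> e = \<one>"
      by (auto simp: kernel_def)
    with ker[OF this(2-4)] show "w \<in> {\<one>\<^bsub>A \<times>\<times> B\<^esub>}" by simp
  qed
  moreover have "\<one>\<^bsub>A \<times>\<times> B\<^esub> \<in> kernel (A \<times>\<times> B) G ?h"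
    using h.hom_one h.G.one_closed by (simp only: kernel_def mem_Collect_eq)
  ultimately have inj: "inj_on ?h (carrier (A \<times>\<times> B))" using h.inj_iff_trivial_ker by blast
  \<comment> \<open>Injectivity in both coordinates together; putting the identity into one of them
    yields the injectivity of \<open>\<alpha>\<close> and of \<open>\<beta>\<close> and their
    trivial intersection.\<close>
  have eq: "x = x' \<and> y = y'" if "x \<in> carrier A" "x' \<in> carrier A" "y \<in> carrier B" "y' \<in> carrier B"
      "\<alpha> x \<otimes> \<beta> y = \<alpha> x' \<otimes> \<beta> y'" for x x' y y'
    using inj_onD[OF inj, of "(x, y)" "(x', y')"] that by simp
  have one: "\<alpha> \<one>\<^bsub>A\<^esub> = \<one>" "\<beta> \<one>\<^bsub>B\<^esub> = \<one>" "\<one>\<^bsub>A\<^esub> \<in> carrier A" "\<one>\<^bsub>B\<^esub> \<in> carrier B"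
    using hom_one[OF \<alpha> A is_group] hom_one[OF \<beta> B is_group]
      monoid.one_closed[OF group.is_monoid[OF A]] monoid.one_closed[OF group.is_monoid[OF B]] by blast+
  have "inj_on \<alpha> (carrier A)"
  proof (rule inj_onI)
    fix x x' assume "x \<in> carrier A" "x' \<in> carrier A" "\<alpha> x = \<alpha> x'"
    then show "x = x'" using eq[of x x' "\<one>\<^bsub>B\<^esub>" "\<one>\<^bsub>B\<^esub>"] one by simp
  qed
  then show "\<alpha> \<in> mon A G" using \<alpha> by (simp add: mon_def)
  have "inj_on \<beta> (carrier B)"
  proof (rule inj_onI)
    fix x x' assume "x \<in> carrier B" "x' \<in> carrier B" "\<beta> x = \<beta> x'"
    then show "x = x'" using eq[of "\<one>\<^bsub>A\<^esub>" "\<one>\<^bsub>A\<^esub>" x x'] one by simp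
  qed
  then show "\<beta> \<in> mon B G" using \<beta> by (simp add: mon_def)
  show "\<alpha> ` carrier A \<inter> \<beta> ` carrier B \<subseteq> {\<one>}"
  proof
    fix w assume "w \<in> \<alpha> ` carrier A \<inter> \<beta> ` carrier B"
    then obtain x y where xy: "x \<in> carrier A" "y \<in> carrier B" "w = \<alpha> x" "\<alpha> x = \<beta> y" by blast
    then have "x = \<one>\<^bsub>A\<^esub>"
      using eq[of x "\<one>\<^bsub>A\<^esub>" "\<one>\<^bsub>B\<^esub>" y] one cG[OF \<alpha>c] cG[OF \<beta>c'] by simp
    then show "w \<in> {\<one>}" using xy one by simp
  qed
  have zim: "z i \<in> ?h ` (carrier A \<times> carrier B)" if i: "i \<in> {1..r}" for i
  proof -
    consider "i = 1" | "i = 2" | "3 \<le> i" using i by fastforce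
    then show ?thesis
    proof cases
      case 1
      have "(1, 0) \<in> carrier A" using p(2) q(2) by (simp add: A_def)
      moreover have "z i = ?h ((1, 0), \<one>\<^bsub>B\<^esub>)" using 1 z[OF 12(1)] one(2) by (simp add: \<alpha>_def)
      ultimately show ?thesis using one(4) by blast
    next
      case 2
      have "(0, 1) \<in> carrier A" using p(2) q(2) by (simp add: A_def)
      moreover have "z i = ?h ((0, 1), \<one>\<^bsub>B\<^esub>)" using 2 z[OF 12(2)] one(2) by (simp add: \<alpha>_def)
      ultimately show ?thesis using one(4) by blast
    next
      case 3
      define j where "j = i - 3"
      have j: "i = j + 3" "j < r - 2" using 3 i by (auto simp: j_def)
      \<comment> \<open>The unit vector at \<open>j\<close>, which \<open>\<beta>\<close> maps to
        the generator \<open>z (j + 3)\<close>.\<close>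
      define e where "e = (\<lambda>l\<in>{..<r - 2}. if l = j then 1 else (0::int))"
      let ?\<phi> = "\<lambda>i e. z (i + 3) [^] (e::int)"
      have "\<beta> e = ordered_product G (?\<phi>(j := \<lambda>_. \<one>)) (r - 2) e \<otimes> ?\<phi> j (e j)"
        unfolding \<beta>_def using j(2) by (intro ordered_product_extract) (auto intro!: int_pow_closed z i3 comm powc)
      moreover have "ordered_product G (?\<phi>(j := \<lambda>_. \<one>)) (r - 2) e \<in> {\<one>}"
        by (rule ordered_product_mem_subgroup[OF triv_subgroup]) (simp add: e_def)
      moreover have "?\<phi> j (e j) = z i" using j z[OF i] by (simp add: e_def)
      ultimately have "z i = ?h (\<one>\<^bsub>A\<^esub>, e)" using one(1) z[OF i] by simp
      moreover have "e \<in> carrier B" by (auto simp: B_def e_def)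
      ultimately show ?thesis using one(3) by blast
    qed
  qed
  have im: "subgroup (?h ` (carrier A \<times> carrier B)) G"
    using h.img_is_subgroup by simp
  show "center G = ?h ` (carrier A \<times> carrier B)"
  proof
    show "center G \<subseteq> ?h ` (carrier A \<times> carrier B)"
      unfolding K
    proof (rule generate_subgroup_incl[OF _ im], rule UN_least)
      fix i assume "i \<in> {1..r}"
      then show "H i \<subseteq> ?h ` (carrier A \<times> carrier B)"
        unfolding H_def using zim by (intro generate_subgroup_incl im) auto
    qed
    show "?h ` (carrier A \<times> carrier B) \<subseteq> center G"
      using \<alpha>c \<beta>c' subgroup.m_closed[OF subgroup_center] by auto
  qed
qed

text \<open>Squaring is an endomorphism of the abelian center. As a subgroup, the set of squares
  contains whatever the squares of \<open>z 1\<close> and \<open>z 2\<close> generate, in particular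
  \<open>N\<close>.\<close>

lemma (in group) subgroup_center_squares: "subgroup ((\<lambda>w. w \<otimes> w) ` center G) G"
proof -
  have carrier: "w \<in> carrier G" if "w \<in> center G" for w
    using that by (simp add: center_def)
  show ?thesis
  proof (rule subgroupI)
    show "(\<lambda>w. w \<otimes> w) ` center G \<subseteq> carrier G" using carrier by blast
    show "(\<lambda>w. w \<otimes> w) ` center G \<noteq> {}"
      using subgroup.one_closed[OF subgroup_center] by blast
  next
    fix a assume "a \<in> (\<lambda>w. w \<otimes> w) ` center G"
    then obtain w where w: "a = w \<otimes> w" "w \<in> center G" by blast
    then have "inv a = inv w \<otimes> inv w" using carrier by (simp add: inv_mult_group)
    then show "inv a \<in> (\<lambda>w. w \<otimes> w) ` center G"
      using subgroup.m_inv_closed[OF subgroup_center w(2)] by (rule image_eqI)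
  next
    fix a b assume "a \<in> (\<lambda>w. w \<otimes> w) ` center G" "b \<in> (\<lambda>w. w \<otimes> w) ` center G"
    then obtain v w where a: "a = v \<otimes> v" "v \<in> center G" and b: "b = w \<otimes> w" "w \<in> center G" by blast
    have "v \<otimes> w = w \<otimes> v" using a(2) carrier[OF b(2)] unfolding center_def by blast
    then have "a \<otimes> b = (v \<otimes> w) \<otimes> (v \<otimes> w)"
      unfolding a(1) b(1) by (intro mult_4_commute carrier a(2) b(2))
    then show "a \<otimes> b \<in> (\<lambda>w. w \<otimes> w) ` center G"
      using subgroup.m_closed[OF subgroup_center a(2) b(2)] by (rule image_eqI)
  qed
qed

section \<open>Assembling the isomorphism\<close>

theorem theorem3p16:
  fixes G :: "('a, 'b) monoid_scheme" (structure)
    and N :: "'a set" and c :: 'a and z :: "nat \<Rightarrow> 'a" and n m r :: nat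
  assumes "1 \<le> m" and "m \<le> n" and "2 \<le> r"
    and "group G" and "finite (carrier G)" and "\<exists>a::nat. order G = 2 ^ a"
    and "\<not> comm_group G"
    and "subgroup N G" and "N \<subseteq> center G"
    and "G\<lparr>carrier := N\<rparr> \<cong> integer_mod_group (2 ^ n) \<times>\<times> integer_mod_group (2 ^ m)"
    and "elementary_abelian_2_group (G Mod N)"
    and "c \<in> carrier G" and "group.ord G c = 2" and "derived G (carrier G) = generate G {c}"
    and "\<forall>i \<in> {1..r}. z i \<in> carrier G"
    and "internal_direct_product G (center G) {1..r} (\<lambda>i. generate G {z i})"
    and "group.ord G (z 1) = 2 ^ (n + 1)" and "group.ord G (z 2) = 2 ^ (m + 1)"
    and "\<forall>i \<in> {3..r}. group.ord G (z i) = 2"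
    and "internal_direct_product G N {1..2::nat} (\<lambda>i. generate G {z i [^] (2::nat)})"
    and "c \<in> generate G {z 1} \<or> c \<in> generate G {z 2}"
  shows "\<exists>k\<ge>1. \<exists>d.
    (c \<in> generate G {z 1} \<and> d = (2 ^ n, 0) \<or> c \<in> generate G {z 2} \<and> d = (0, 2 ^ m)) \<and>
    (G \<cong> group_i n m r k d \<or> G \<cong> group_ii n m r k d)"
proof -
  interpret group G by fact
  have zG: "\<And>i. i \<in> {1..r} \<Longrightarrow> z i \<in> carrier G" using \<open>\<forall>i \<in> {1..r}. z i \<in> carrier G\<close> by blast
  have r12: "1 \<in> {1..r}" "2 \<in> {1..r}" using \<open>2 \<le> r\<close> by auto
  have idp: "internal_direct_product G (center G) {1..r} (\<lambda>i. generate G {z i})" by fact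
  have zcenter: "generate G {z i} \<subseteq> center G" if "i \<in> {1..r}" for i
  proof (rule generate_subgroup_incl[OF _ subgroup_center])
    have "z i \<in> (\<Union>i\<in>{1..r}. generate G {z i})"
      using that generate.incl[of "z i" "{z i}" G] by blast
    then have "z i \<in> generate G (\<Union>i\<in>{1..r}. generate G {z i})" by (rule generate.incl)
    then show "{z i} \<subseteq> center G" using idp unfolding internal_direct_product_def by blast
  qed
  have cc: "x \<otimes> y = y \<otimes> x" if "x \<in> carrier G" "y \<in> center G" for x y
    using that by (simp add: center_def)
  have cG': "x \<in> carrier G" if "x \<in> center G" for x using that by (simp add: center_def)
  have cG: "c \<in> carrier G" and cord: "ord c = 2" by fact+
  have c1: "c \<noteq> \<one>" using ord_eq_1[OF cG] cord by auto
  have c2: "c \<otimes> c = \<one>" using pow_ord_eq_1[OF cG] cG by (simp add: cord numeral_2_eq_2)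
  have cz: "c \<in> generate G {z 1} \<or> c \<in> generate G {z 2}" by fact
  then have "c \<in> center G" using zcenter[OF r12(1)] zcenter[OF r12(2)] by blast
  then have c: "central_involution G c" using c1 c2 by (simp add: central_involution_def)

  have comm: "\<forall>x\<in>carrier G. \<forall>y\<in>carrier G. x \<otimes> y = y \<otimes> x \<or> x \<otimes> y = c \<otimes> (y \<otimes> x)"
  proof (intro ballI)
    fix x y assume xy: "x \<in> carrier G" "y \<in> carrier G"
    have "x \<otimes> y \<otimes> inv x \<otimes> inv y \<in> derived G (carrier G)"
      unfolding derived_def using xy by (intro generate.incl) blast
    then have "x \<otimes> y \<otimes> inv x \<otimes> inv y \<in> {\<one>, c}"
      using generate_one_or_involution[OF cG c2] \<open>derived G (carrier G) = generate G {c}\<close> by blast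
    moreover have "x \<otimes> y = (x \<otimes> y \<otimes> inv x \<otimes> inv y) \<otimes> (y \<otimes> x)"
      using xy by (simp add: m_assoc inv_solve_left')
    ultimately show "x \<otimes> y = y \<otimes> x \<or> x \<otimes> y = c \<otimes> (y \<otimes> x)"
      using xy by auto
  qed

  have sq: "\<forall>x \<in> carrier G. \<exists>w \<in> center G. (x \<otimes> w) \<otimes> (x \<otimes> w) = \<one>"
  proof
    fix x assume x: "x \<in> carrier G"
    interpret N: normal N G
      using \<open>subgroup N G\<close> \<open>N \<subseteq> center G\<close> by (rule central_subgroup_normal)
    have "N #> x \<in> carrier (G Mod N)" using x by (simp add: carrier_FactGroup)
    then have "(N #> x) <#> (N #> x) = N"
      using \<open>elementary_abelian_2_group (G Mod N)\<close>
      by (simp add: elementary_abelian_2_group_def)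
    then have "N #> (x \<otimes> x) = N" using x by (simp add: N.rcos_sum)
    then have "x \<otimes> x \<in> N" using x coset_join1[OF _ _ N.subgroup_axioms] by blast
    moreover have "N \<subseteq> (\<lambda>w. w \<otimes> w) ` center G"
    proof -
      have "N = generate G (\<Union>i\<in>{1..2::nat}. generate G {z i [^] (2::nat)})"
        using \<open>internal_direct_product G N {1..2::nat} (\<lambda>i. generate G {z i [^] (2::nat)})\<close>
        unfolding internal_direct_product_def by blast
      also have "\<dots> \<subseteq> (\<lambda>w. w \<otimes> w) ` center G"
      proof (rule generate_subgroup_incl[OF UN_least subgroup_center_squares])
        fix i :: nat assume "i \<in> {1..2}"
        then have i: "i \<in> {1..r}" using \<open>2 \<le> r\<close> by simp
        then have "z i \<in> center G" using zcenter generate.incl[of "z i" "{z i}" G] by blast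
        moreover have "z i [^] (2::nat) = z i \<otimes> z i" using zG[OF i] by (simp add: numeral_2_eq_2)
        ultimately have "{z i [^] (2::nat)} \<subseteq> (\<lambda>w. w \<otimes> w) ` center G" by blast
        then show "generate G {z i [^] (2::nat)} \<subseteq> (\<lambda>w. w \<otimes> w) ` center G"
          by (rule generate_subgroup_incl[OF _ subgroup_center_squares])
      qed
      finally show ?thesis .
    qed
    ultimately obtain w where w: "w \<in> center G" "x \<otimes> x = w \<otimes> w" by blast
    have w': "inv w \<in> center G" using subgroup.m_inv_closed[OF subgroup_center w(1)] .
    have "(x \<otimes> inv w) \<otimes> (x \<otimes> inv w) = (x \<otimes> x) \<otimes> (inv w \<otimes> inv w)"
      by (rule mult_4_commute[OF x cG'[OF w'] x cG'[OF w'] cc[OF x w', symmetric]])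
    also have "\<dots> = \<one>" unfolding w(2) using mult_4_commute[of w w "inv w" "inv w"] cG'[OF w(1)] by simp
    finally show "\<exists>w \<in> center G. (x \<otimes> w) \<otimes> (x \<otimes> w) = \<one>" using w' by blast
  qed

  have "center G \<subseteq> carrier G" by (auto simp: center_def)
  from dihedral_decomposition[OF \<open>finite (carrier G)\<close> c comm sq subgroup_self this]
  obtain k \<phi> where \<phi>: "\<forall>i<k. \<phi> i \<in> hom D8 G \<and> \<phi> i (2, 0) = c \<and> \<phi> i ` carrier D8 \<subseteq> carrier G"
    and \<phi>comm: "\<forall>i<k. \<forall>j<k. i \<noteq> j \<longrightarrow> (\<forall>p\<in>carrier D8. \<forall>q\<in>carrier D8. \<phi> i p \<otimes> \<phi> j q = \<phi> j q \<otimes> \<phi> i p)"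
    and cover: "\<forall>g\<in>carrier G. \<exists>f\<in>carrier (product_group {..<k} (\<lambda>_. D8)). \<exists>w\<in>carrier G.
      (\<forall>s\<in>carrier G. w \<otimes> s = s \<otimes> w) \<and> g = ordered_product G \<phi> k f \<otimes> w"
    by (elim exE conjE)
  \<comment> \<open>Without a dihedral factor every element would equal its central part
    \<open>w\<close>, and \<open>G\<close> would be commutative.\<close>
  have k: "1 \<le> k"
  proof (rule ccontr)
    assume "\<not> 1 \<le> k"
    then have "k = 0" by simp
    have "\<forall>g\<in>carrier G. \<forall>s\<in>carrier G. g \<otimes> s = s \<otimes> g"
    proof (intro ballI)
      fix g s assume "g \<in> carrier G" and s: "s \<in> carrier G"
      then obtain f w where "w \<in> carrier G" "\<forall>s\<in>carrier G. w \<otimes> s = s \<otimes> w" "g = ordered_product G \<phi> k f \<otimes> w"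
        using cover by blast
      then show "g \<otimes> s = s \<otimes> g" using s \<open>k = 0\<close> by simp
    qed
    then have "comm_group G" by (intro group_comm_groupI) blast
    then show False using \<open>\<not> comm_group G\<close> by simp
  qed

  define A where "A = integer_mod_group (2 ^ (n + 1)) \<times>\<times> integer_mod_group (2 ^ (m + 1))"
  define B where "B = product_group {..<r - 2} (\<lambda>_. integer_mod_group 2)"
  define \<alpha> where "\<alpha> = (\<lambda>(a, b). z 1 [^] (a::int) \<otimes> z 2 [^] (b::int))"
  define \<beta> where "\<beta> = ordered_product G (\<lambda>i e. z (i + 3) [^] (e::int)) (r - 2)"
  have z1: "ord (z 1) = 2 ^ (n + 1)" and z2: "ord (z 2) = 2 ^ (m + 1)" by fact+
  have "(1::nat) < 2 ^ (n + 1)" "(1::nat) < 2 ^ (m + 1)" by (rule one_less_power; simp)+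
  note center = center_decomposition[OF idp \<open>2 \<le> r\<close> zG z1 this(1) z2 this(2)
      bspec[OF \<open>\<forall>i \<in> {3..r}. ord (z i) = 2\<close>], folded A_def B_def, folded \<alpha>_def \<beta>_def]
  have \<alpha>: "\<alpha> \<in> mon A G" and \<beta>: "\<beta> \<in> mon B G" and \<alpha>\<beta>: "\<alpha> ` carrier A \<inter> \<beta> ` carrier B \<subseteq> {\<one>}"
    and ZAB: "center G = (\<lambda>(x, y). \<alpha> x \<otimes> \<beta> y) ` (carrier A \<times> carrier B)"
    and \<alpha>c: "\<And>x. x \<in> carrier A \<Longrightarrow> \<alpha> x \<in> center G" and \<beta>c: "\<And>y. y \<in> carrier B \<Longrightarrow> \<beta> y \<in> center G"
    using center by blast+
  have A: "group A" unfolding A_def by (intro DirProd_group group_integer_mod_group)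
  have B: "group B" unfolding B_def by (intro product_group group_integer_mod_group)
  have \<alpha>h: "\<alpha> \<in> hom A G" using \<alpha> by (simp add: mon_def)

  \<comment> \<open>The nonzero entry of \<open>d\<close> is half the modulus, placed in the
    coordinate whose cyclic group contains \<open>c\<close>; \<open>\<alpha>\<close> maps it to the
    only involution there, which is \<open>c\<close>.\<close>
  obtain d where d: "c \<in> generate G {z 1} \<and> d = (2 ^ n, 0) \<or> c \<in> generate G {z 2} \<and> d = (0, 2 ^ m)"
    and dA: "central_involution A d" and \<alpha>d: "\<alpha> d = c"
    using cz
  proof
    assume c': "c \<in> generate G {z 1}"
    show thesis
    proof
      show "c \<in> generate G {z 1} \<and> (2 ^ n, 0) = (2 ^ n, 0::int) \<or> c \<in> generate G {z 2} \<and> (2 ^ n, 0::int) = (0, 2 ^ m)"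
        using c' by simp
      show "central_involution A (2 ^ n, 0)"
        using central_involution_integer_mod_group[of n] unfolding A_def
        by (auto simp: central_involution_def center_def carrier_integer_mod_group)
      show "\<alpha> (2 ^ n, 0) = c"
        using involution_generate_pow[OF zG[OF r12(1)] z1 c' c1 c2] cG by (simp add: \<alpha>_def)
    qed
  next
    assume c': "c \<in> generate G {z 2}"
    show thesis
    proof
      show "c \<in> generate G {z 1} \<and> (0, 2 ^ m) = (2 ^ n, 0::int) \<or> c \<in> generate G {z 2} \<and> (0, 2 ^ m) = (0::int, 2 ^ m::int)"
        using c' by simp
      show "central_involution A (0, 2 ^ m)"
        using central_involution_integer_mod_group[of m] unfolding A_def
        by (auto simp: central_involution_def center_def carrier_integer_mod_group)
      show "\<alpha> (0, 2 ^ m) = c"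
        using involution_generate_pow[OF zG[OF r12(2)] z2 c' c1 c2] cG by (simp add: \<alpha>_def)
    qed
  qed

  let ?F = "\<lambda>_::nat. D8" and ?e = "\<lambda>_::nat. (2::int, 0::int)"
  define P where "P = central_product_family {..<k} ?F ?e"
  define C where "C = common_involution {..<k} ?F ?e"
  have P: "group P" unfolding P_def
    by (rule group_central_product_family) (simp_all add: group_D8 central_involution_D8)
  have C: "central_involution P C" unfolding P_def C_def
    using k by (intro central_involution_family) (auto simp: group_D8 central_involution_D8 lessThan_empty_iff)
  \<comment> \<open>The central involution of \<open>D8\<close> goes to \<open>c\<close>, which is
    not \<open>\<one>\<close>; this alone forces injectivity.\<close>
  have \<phi>mon: "\<phi> i \<in> mon D8 G" if "i < k" for i
    using \<phi> that inj_on_hom_D8[OF is_group, of "\<phi> i"] c1 by (simp add: mon_def)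
  have "\<exists>f. f \<in> mon P G \<and>
    f ` carrier P = ordered_product G \<phi> k ` carrier (product_group {..<k} ?F) \<and>
    f C = c \<and> f ` carrier P \<inter> center G \<subseteq> {\<one>, c}"
  proof (rule central_product_family_embedding[OF c, of k ?F ?e \<phi>])
    show "center D8 = {\<one>\<^bsub>D8\<^esub>, (2, 0)}" by (simp add: center_D8 one_D8)
    show "\<phi> i \<in> mon D8 G" if "i < k" for i by (rule \<phi>mon[OF that])
    show "\<phi> i (2, 0) = c" if "i < k" for i using \<phi> that by blast
    show "\<phi> i p \<otimes> \<phi> j q = \<phi> j q \<otimes> \<phi> i p"
      if "i < k" "j < k" "i \<noteq> j" "p \<in> carrier D8" "q \<in> carrier D8" for i j p q
      using \<phi>comm that by blast
  next
    fix g
    assume "g \<in> mon (central_product_family {..<k} ?F ?e) G"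
      and "g ` carrier (central_product_family {..<k} ?F ?e) =
        ordered_product G \<phi> k ` carrier (product_group {..<k} ?F)"
      and "1 \<le> k \<Longrightarrow> g (common_involution {..<k} ?F ?e) = c"
      and "g ` carrier (central_product_family {..<k} ?F ?e) \<inter> center G \<subseteq> {\<one>, c}"
    then show ?thesis
      using k unfolding P_def C_def by blast
  qed (rule group_D8 central_involution_D8)+
  then obtain f where f: "f \<in> mon P G"
    and fim: "f ` carrier P = ordered_product G \<phi> k ` carrier (product_group {..<k} ?F)"
    and fC: "f C = c" and fcenter: "f ` carrier P \<inter> center G \<subseteq> {\<one>, c}"
    by blast

  have fG: "f x \<in> carrier G" if "x \<in> carrier P" for x
    using f that hom_in_carrier[of f P G x] by (simp add: mon_def)

  define L where "L = central_product P C A d"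
  have L: "group L" unfolding L_def by (rule group_central_product[OF P A C dA])
  have "\<exists>g. g \<in> mon L G \<and> g ` carrier L = (\<lambda>(x, y). f x \<otimes> \<alpha> y) ` (carrier P \<times> carrier A)"
    unfolding L_def
  proof (rule central_product_embedding[OF P A C dA f \<alpha>])
    show "f x \<otimes> \<alpha> y = \<alpha> y \<otimes> f x" if "x \<in> carrier P" "y \<in> carrier A" for x y
      by (rule cc[OF fG[OF that(1)] \<alpha>c[OF that(2)]])
    show "f C = \<alpha> d" by (simp only: fC \<alpha>d)
    \<comment> \<open>The values of \<open>\<alpha>\<close> are central, and the image of
      \<open>f\<close> has no central elements besides \<open>\<one>\<close> and
      \<open>c\<close>.\<close>
    show "f ` carrier P \<inter> \<alpha> ` carrier A \<subseteq> {\<one>, f C}"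
      unfolding fC using fcenter image_subsetI[of "carrier A" \<alpha> "center G", OF \<alpha>c] by blast
  qed (intro exI conjI)
  then obtain g where g: "g \<in> mon L G"
    and gim: "g ` carrier L = (\<lambda>(x, y). f x \<otimes> \<alpha> y) ` (carrier P \<times> carrier A)"
    by blast
  have gG: "g x \<in> carrier G" if "x \<in> carrier L" for x
    using g that hom_in_carrier[of g L G x] by (simp add: mon_def)

  have "L \<times>\<times> B \<cong> G"
  proof (rule DirProd_iso[OF L B g \<beta> cc[OF gG \<beta>c]])
    \<comment> \<open>A common element \<open>t\<close> is central, hence so is its dihedral part
      \<open>f x\<close>, which is then \<open>\<one>\<close> or \<open>c\<close>. Both are values
      of \<open>\<alpha>\<close>, the second at \<open>d\<close>, so \<open>t\<close> lies in the
      image of \<open>\<alpha>\<close>, which meets that of \<open>\<beta>\<close>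
      trivially.\<close>
    show "g ` carrier L \<inter> \<beta> ` carrier B \<subseteq> {\<one>}"
    proof
      fix t assume t: "t \<in> g ` carrier L \<inter> \<beta> ` carrier B"
      then obtain x y where xy: "x \<in> carrier P" "y \<in> carrier A" "t = f x \<otimes> \<alpha> y"
        unfolding gim by auto
      obtain v where "v \<in> carrier B" "t = \<beta> v" using t by blast
      then have tc: "t \<in> center G" using \<beta>c by simp
      have "f x = t \<otimes> inv (\<alpha> y)"
        using fG[OF xy(1)] cG'[OF \<alpha>c[OF xy(2)]] by (simp add: xy(3) m_assoc)
      also have "\<dots> \<in> center G"
        using subgroup.m_closed[OF subgroup_center tc] subgroup.m_inv_closed[OF subgroup_center \<alpha>c[OF xy(2)]] by blast
      finally have "f x \<in> {\<one>, c}" using fcenter xy(1) by blast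
      moreover have "\<alpha> \<one>\<^bsub>A\<^esub> = \<one>" using hom_one[OF \<alpha>h A is_group] .
      moreover have "\<one>\<^bsub>A\<^esub> \<in> carrier A" "d \<in> carrier A"
        using monoid.one_closed[OF group.is_monoid[OF A]] central_involutionD(1)[OF dA] by blast+
      ultimately obtain u where u: "u \<in> carrier A" "f x = \<alpha> u" using \<alpha>d by (metis insertE singletonD)
      then have "t = \<alpha> (u \<otimes>\<^bsub>A\<^esub> y)" using xy hom_mult[OF \<alpha>h, of u y] by simp
      moreover have "u \<otimes>\<^bsub>A\<^esub> y \<in> carrier A"
        using u xy monoid.m_closed[OF group.is_monoid[OF A]] by blast
      ultimately show "t \<in> {\<one>}" using \<alpha>\<beta> t by blast
    qed
    \<comment> \<open>The central part \<open>w\<close> is split by its coordinates: its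
      \<open>\<alpha>\<close>-part joins the dihedral part inside \<open>L\<close>, its
      \<open>\<beta>\<close>-part is the component in \<open>B\<close>.\<close>
    show "carrier G \<subseteq> (\<lambda>(x, y). g x \<otimes> \<beta> y) ` (carrier L \<times> carrier B)"
    proof
      fix t assume "t \<in> carrier G"
      then obtain h w where h: "h \<in> carrier (product_group {..<k} ?F)" and "w \<in> carrier G"
        "\<forall>s\<in>carrier G. w \<otimes> s = s \<otimes> w" and t: "t = ordered_product G \<phi> k h \<otimes> w"
        using cover by blast
      then have "w \<in> center G" by (simp add: center_def)
      then obtain a b where ab: "a \<in> carrier A" "b \<in> carrier B" "w = \<alpha> a \<otimes> \<beta> b" unfolding ZAB by auto
      obtain x where x: "x \<in> carrier P" "ordered_product G \<phi> k h = f x" using fim h by blast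
      have "f x \<otimes> \<alpha> a \<in> g ` carrier L" unfolding gim using x(1) ab(1) by force
      then obtain l where l: "l \<in> carrier L" "f x \<otimes> \<alpha> a = g l" by blast
      have "t = g l \<otimes> \<beta> b"
        unfolding t ab(3) l(2)[symmetric] x(2)
        using fG[OF x(1)] cG'[OF \<alpha>c[OF ab(1)]] cG'[OF \<beta>c[OF ab(2)]] by (simp add: m_assoc)
      then show "t \<in> (\<lambda>(x, y). g x \<otimes> \<beta> y) ` (carrier L \<times> carrier B)"
        using l(1) ab(2) by force
    qed
  qed
  moreover have "group_i n m r k d = L \<times>\<times> B"
    by (simp add: group_i_def listed_group_def L_def P_def C_def A_def B_def)
  ultimately have "G \<cong> group_i n m r k d"
    using group.iso_sym[OF DirProd_group[OF L B]] by simp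
  then show ?thesis using k d by blast
qed

end
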